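(* For a finite connected multigraph $G$ with nullity $n(G)$, the number of sub-coregraphs satisfies $$2^{n(G)}\le|\mathcal C(G)|\le\Big(\frac{5-\sqrt5}{2}\Big)^{n(G)-1}+\Big(\frac{5+\sqrt5}{2}\Big)^{n(G)-1}.$$ The lower bound is attained if and only if $\mathrm{core}(G)$ is a subdivision of a bouquet graph, and the upper bound is attained if and only if $\mathrm{core}(G)$ is a subdivision of a $3$-regular graph or $G$ is a tree.
   Context: Multigraphs may have loops (counted twice in degrees) and multiple edges. Nullity $n(G)=|E|-|V|+k(G)$, $k(G)$ the number of connected components. $\mathcal C(G)=\{s\subset E:\ \text{the spanning subgraph }(V,s)\text{ has no vertex of degree one}\}$ (sub-coregraphs; $s=\emptyset$ is included). $\mathrm{core}(G)$ is obtained by repeatedly deleting a vertex of degree one together with its incident edge until no such vertex remains. A subdivision of a graph is obtained by inserting vertices of degree two on edges. The bouquet graph $B_n$ has one vertex and $n$ loops.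
   Formalization: The upper-bound equality clause adds a third case, core(G) a subdivision of B_1 (a cycle, i.e. n(G)=1): there the bound 2 is attained, yet core(G) is no subdivision of a 3-regular graph and G is no tree. B_0 (a single vertex) counts as a bouquet. *)

theory Defs
  imports Complex_Main "HOL-Library.Multiset"
begin

text \<open>The ends of an edge form a two-element multiset; a loop at \<open>v\<close> has ends
  \<open>{#v, v#}\<close> and so contributes two to the degree of \<open>v\<close>.  The values of \<open>ends\<close>
  outside \<open>edges\<close> are irrelevant.\<close>

record ('v, 'e) mgraph =
  verts :: "'v set"
  edges :: "'e set"
  ends :: "'e \<Rightarrow> 'v multiset"

definition multigraph :: "('v, 'e) mgraph \<Rightarrow> bool" where
  "multigraph G \<longleftrightarrow>
     (\<forall>e\<in>edges G. size (ends G e) = 2 \<and> set_mset (ends G e) \<subseteq> verts G)"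

definition finite_multigraph :: "('v, 'e) mgraph \<Rightarrow> bool" where
  "finite_multigraph G \<longleftrightarrow> multigraph G \<and> finite (verts G) \<and> finite (edges G)"

definition degree :: "('v, 'e) mgraph \<Rightarrow> 'v \<Rightarrow> nat" where
  "degree G v = (\<Sum>e\<in>edges G. count (ends G e) v)"

definition regular :: "nat \<Rightarrow> ('v, 'e) mgraph \<Rightarrow> bool" where
  "regular k G \<longleftrightarrow> (\<forall>v\<in>verts G. degree G v = k)"

definition adjacency :: "('v, 'e) mgraph \<Rightarrow> ('v \<times> 'v) set" where
  "adjacency G = {(u, v). \<exists>e\<in>edges G. ends G e = {#u, v#}}"

definition components :: "('v, 'e) mgraph \<Rightarrow> 'v set set" where
  "components G = verts G // ((adjacency G)\<^sup>* \<inter> verts G \<times> verts G)"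

definition connected_mgraph :: "('v, 'e) mgraph \<Rightarrow> bool" where
  "connected_mgraph G \<longleftrightarrow>
     verts G \<noteq> {} \<and> (\<forall>u\<in>verts G. \<forall>v\<in>verts G. (u, v) \<in> (adjacency G)\<^sup>*)"

definition nullity :: "('v, 'e) mgraph \<Rightarrow> int" where
  "nullity G = int (card (edges G)) - int (card (verts G)) + int (card (components G))"

text \<open>Cycles of length one (loops) and two (pairs of parallel edges) are included.\<close>

definition is_cycle :: "('v, 'e) mgraph \<Rightarrow> 'v list \<Rightarrow> 'e list \<Rightarrow> bool" where
  "is_cycle G vs es \<longleftrightarrow>
     es \<noteq> [] \<and> length vs = length es \<and> distinct vs \<and> distinct es \<and>
     set vs \<subseteq> verts G \<and> set es \<subseteq> edges G \<and>
     (\<forall>i<length es. ends G (es ! i) = {#vs ! i, vs ! (Suc i mod length vs)#})"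

definition tree :: "('v, 'e) mgraph \<Rightarrow> bool" where
  "tree G \<longleftrightarrow> connected_mgraph G \<and> (\<nexists>vs es. is_cycle G vs es)"

definition sub_coregraphs :: "('v, 'e) mgraph \<Rightarrow> 'e set set" where
  "sub_coregraphs G =
     {s. s \<subseteq> edges G \<and> (\<forall>v\<in>verts G. degree (G\<lparr>edges := s\<rparr>) v \<noteq> 1)}"

definition delete_leaf :: "('v, 'e) mgraph \<Rightarrow> ('v, 'e) mgraph \<Rightarrow> bool" where
  "delete_leaf G H \<longleftrightarrow>
     (\<exists>v e. v \<in> verts G \<and> degree G v = 1 \<and> e \<in> edges G \<and> v \<in># ends G e \<and>
        H = G\<lparr>verts := verts G - {v}, edges := edges G - {e}\<rparr>)"

text \<open>The result of the deletion process depends on the order of the deletions, but only up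
  to isomorphism (from a single edge, either end may be the one that survives); \<open>SOME\<close>
  fixes one of the possible results.  One exists by \<open>core_exists\<close> below.\<close>

definition core :: "('v, 'e) mgraph \<Rightarrow> ('v, 'e) mgraph" where
  "core G = (SOME H. delete_leaf\<^sup>*\<^sup>* G H \<and> (\<forall>v\<in>verts H. degree H v \<noteq> 1))"

definition isomorphic :: "('v, 'e) mgraph \<Rightarrow> ('w, 'f) mgraph \<Rightarrow> bool" where
  "isomorphic G H \<longleftrightarrow>
     (\<exists>f g. bij_betw f (verts G) (verts H) \<and> bij_betw g (edges G) (edges H) \<and>
        (\<forall>e\<in>edges G. ends H (g e) = image_mset f (ends G e)))"

text \<open>One new vertex \<open>w\<close> is inserted on the edge \<open>e\<close>, which is replaced by the two new
  edges \<open>e1\<close> and \<open>e2\<close>.\<close>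

definition insert_vertex :: "('v, 'e) mgraph \<Rightarrow> ('v, 'e) mgraph \<Rightarrow> bool" where
  "insert_vertex G H \<longleftrightarrow>
     (\<exists>e u v w e1 e2.
        e \<in> edges G \<and> ends G e = {#u, v#} \<and>
        w \<notin> verts G \<and> e1 \<notin> edges G \<and> e2 \<notin> edges G \<and> e1 \<noteq> e2 \<and>
        H = \<lparr>verts = insert w (verts G),
             edges = insert e1 (insert e2 (edges G - {e})),
             ends = (ends G)(e1 := {#u, w#}, e2 := {#w, v#})\<rparr>)"

text \<open>\<open>is_subdivision K H\<close> means that \<open>K\<close> is a subdivision of \<open>H\<close>, with zero insertions
  allowed.\<close>

definition is_subdivision :: "('v, 'e) mgraph \<Rightarrow> ('w, 'f) mgraph \<Rightarrow> bool" where
  "is_subdivision K H \<longleftrightarrow> (\<exists>K'. insert_vertex\<^sup>*\<^sup>* H K' \<and> isomorphic K K')"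

definition bouquet :: "nat \<Rightarrow> (nat, nat) mgraph" where
  "bouquet n = \<lparr>verts = {0}, edges = {..<n}, ends = (\<lambda>_. {#0, 0#})\<rparr>"

definition subdivision_of_bouquet :: "('v, 'e) mgraph \<Rightarrow> bool" where
  "subdivision_of_bouquet K \<longleftrightarrow> (\<exists>n. is_subdivision K (bouquet n))"

text \<open>Vertices and edges of the 3-regular graph are taken to be natural numbers, which is no
  restriction: every finite multigraph is isomorphic to one of this kind.\<close>

definition subdivision_of_3_regular :: "('v, 'e) mgraph \<Rightarrow> bool" where
  "subdivision_of_3_regular K \<longleftrightarrow>
     (\<exists>H :: (nat, nat) mgraph. finite_multigraph H \<and> regular 3 H \<and> is_subdivision K H)"

text \<open>Graphs of nullity one are an exceptional case for the upper bound.  There the bound is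
  \<open>1 + 1 = 2\<close>, and it is attained, since the sub-coregraphs are the empty set and the unique
  cycle; but the core is a cycle, which is not a subdivision of a 3-regular graph unless a
  circle without vertices is admitted as one.  The predicate below describes these cores.\<close>

definition subdivision_of_loop :: "('v, 'e) mgraph \<Rightarrow> bool" where
  "subdivision_of_loop K \<longleftrightarrow> is_subdivision K (bouquet 1)"

lemma core_exists:
  fixes G :: "('v, 'e) mgraph"
  assumes "finite (verts G)"
  shows "\<exists>H. delete_leaf\<^sup>*\<^sup>* G H \<and> (\<forall>v\<in>verts H. degree H v \<noteq> 1)"
  using assms
proof (induction "card (verts G)" arbitrary: G rule: less_induct)
  case less
  show ?case
  proof (cases "\<exists>v\<in>verts G. degree G v = 1")
    case False
    then show ?thesis by blast
  next
    case True
    then obtain v where v: "v \<in> verts G" "degree G v = 1" by blast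
    have "\<exists>e\<in>edges G. count (ends G e) v \<noteq> 0"
    proof (rule ccontr)
      assume "\<not> (\<exists>e\<in>edges G. count (ends G e) v \<noteq> 0)"
      then have "degree G v = 0" unfolding degree_def by (intro sum.neutral) blast
      with v show False by simp
    qed
    then obtain e where e: "e \<in> edges G" "v \<in># ends G e"
      by (auto simp: not_in_iff)
    define G' where "G' = G\<lparr>verts := verts G - {v}, edges := edges G - {e}\<rparr>"
    have step: "delete_leaf G G'"
      using v e unfolding delete_leaf_def G'_def by blast
    have "card (verts G') < card (verts G)" "finite (verts G')"
      using card_Diff1_less[OF less.prems v(1)] less.prems by (simp_all add: G'_def)
    then obtain H where "delete_leaf\<^sup>*\<^sup>* G' H" "\<forall>v\<in>verts H. degree H v \<noteq> 1"
      using less.hyps by blast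
    with step show ?thesis by (meson converse_rtranclp_into_rtranclp)
  qed
qed

lemma core_spec:
  assumes "finite_multigraph G"
  shows "delete_leaf\<^sup>*\<^sup>* G (core G)" "\<forall>v\<in>verts (core G). degree (core G) v \<noteq> 1"
  using someI_ex[OF core_exists[of G]] assms
  unfolding core_def finite_multigraph_def by auto

end

theory Submission imports Defs begin

text \<open>If \<open>f a * f b + f (a + 1) * f (b + 1) = f (a + b)\<close> for all \<open>a\<close>, \<open>b\<close>, then the sum over all
  edge sets \<open>s\<close> of the product of the values of \<open>f\<close> at the degrees of \<open>(V, s)\<close> does not change
  when an edge that is not a loop is contracted.  On a connected graph it is therefore the value
  on a bouquet, which depends only on the nullity.  Two weights satisfy the identity: the
  indicator of the even numbers, with total \<open>2 ^ n(G)\<close>, and the Fibonacci numbers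
  1, 0, 1, 1, 2, 3, ..., with total the upper bound.  Counting sub-coregraphs means using the
  indicator of the numbers other than 1, which lies between the two weights, so the lower bound
  is attained iff all degrees of all sub-coregraphs are even, and the upper bound iff they are
  all at most 3.  Suppressing the vertices of degree two
  of the core leaves one vertex or a graph of minimum degree 3; in the latter an edge that is
  not a loop can be removed from the full edge set, which changes the parity of a degree.\<close>

section \<open>Degrees of edge subsets, connectedness and nullity\<close>

abbreviation sdeg :: "('v, 'e) mgraph \<Rightarrow> 'e set \<Rightarrow> 'v \<Rightarrow> nat" where
  "sdeg G s v \<equiv> degree (G\<lparr>edges := s\<rparr>) v"

lemma sdeg_eq_sum: "sdeg G s v = (\<Sum>e\<in>s. count (ends G e) v)"
  by (simp add: degree_def)

lemma sdeg_edges [simp]: "sdeg G (edges G) v = degree G v"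
  by (simp add: degree_def)

lemma sdeg_mono:
  assumes "finite t" "s \<subseteq> t"
  shows "sdeg G s v \<le> sdeg G t v"
  unfolding sdeg_eq_sum using assms by (simp add: sum_mono2)

lemma sdeg_remove:
  assumes "finite s" "e \<in> s"
  shows "sdeg G s v = count (ends G e) v + sdeg G (s - {e}) v"
  unfolding sdeg_eq_sum using assms by (simp add: sum.remove)

lemma sdeg_insert:
  assumes "finite s" "e \<notin> s"
  shows "sdeg G (insert e s) v = count (ends G e) v + sdeg G s v"
  unfolding sdeg_eq_sum using assms by simp

lemma finite_multigraphD:
  assumes "finite_multigraph G"
  shows "finite (verts G)" "finite (edges G)"
    "\<And>e. e \<in> edges G \<Longrightarrow> size (ends G e) = 2"
    "\<And>e x. e \<in> edges G \<Longrightarrow> x \<in># ends G e \<Longrightarrow> x \<in> verts G"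
  using assms unfolding finite_multigraph_def multigraph_def by auto

lemma size_two_witness:
  assumes "size M = 2" "w \<in># M"
  obtains x where "M = {#w, x#}"
proof -
  from assms obtain N where N: "M = add_mset w N" by (metis insert_DiffM)
  with assms have "size N = 1" by simp
  then obtain x where "N = {#x#}" by (metis size_1_singleton_mset)
  with N that show thesis by blast
qed

text \<open>Mapping a walk of \<open>G\<close> through \<open>r\<close> edge by edge yields a walk
  of \<open>H\<close>. This serves contraction, leaf deletion and suppression alike: each removes
  one vertex, and \<open>r\<close> sends that vertex to a neighbour and fixes all others.\<close>

lemma connected_retract:
  assumes "connected_mgraph G" "verts H \<subseteq> verts G" "verts H \<noteq> {}"
    and r: "\<And>x. x \<in> verts H \<Longrightarrow> r x = x"
    and adj: "\<And>e x y. e \<in> edges G \<Longrightarrow> ends G e = {#x, y#} \<Longrightarrow> (r x, r y) \<in> (adjacency H)\<^sup>*"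
  shows "connected_mgraph H"
proof -
  have walk: "(r x, r y) \<in> (adjacency H)\<^sup>*" if "(x, y) \<in> (adjacency G)\<^sup>*" for x y
    using that
  proof induction
    case (step y z)
    from step.hyps(2) have "(r y, r z) \<in> (adjacency H)\<^sup>*"
      using adj by (auto simp: adjacency_def)
    with step.IH show ?case by (rule rtrancl_trans)
  qed simp
  show ?thesis
    unfolding connected_mgraph_def
  proof (intro conjI ballI)
    fix x y assume xy: "x \<in> verts H" "y \<in> verts H"
    then have "(x, y) \<in> (adjacency G)\<^sup>*"
      using assms(1,2) unfolding connected_mgraph_def by blast
    from walk[OF this] show "(x, y) \<in> (adjacency H)\<^sup>*" using xy r by simp
  qed (fact assms(3))
qed

lemma adjacency_edge:
  assumes "e \<in> edges H" "ends H e = {#x, y#}"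
  shows "(x, y) \<in> (adjacency H)\<^sup>*"
  using assms by (auto simp: adjacency_def)

text \<open>On a walk from \<open>v\<close> to \<open>w\<close> the first step that leaves
  \<open>v\<close> uses an edge that is not a loop.\<close>

lemma connected_nonloop:
  assumes "finite_multigraph G" "connected_mgraph G" "v \<in> verts G" "w \<in> verts G" "v \<noteq> w"
  obtains e u where "e \<in> edges G" "ends G e = {#v, u#}" "u \<noteq> v" "u \<in> verts G"
proof -
  have "(v, w) \<in> (adjacency G)\<^sup>*" using assms unfolding connected_mgraph_def by blast
  then have "\<exists>u. (v, u) \<in> adjacency G \<and> u \<noteq> v"
    using \<open>v \<noteq> w\<close> by (induction rule: converse_rtrancl_induct) blast+
  then obtain u e where "e \<in> edges G" "ends G e = {#v, u#}" "u \<noteq> v"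
    unfolding adjacency_def by auto
  moreover from this have "u \<in> verts G" using finite_multigraphD(4)[OF assms(1)] by auto
  ultimately show thesis using that by blast
qed

lemma nullity_connected:
  assumes "connected_mgraph G"
  shows "nullity G = int (card (edges G)) - int (card (verts G)) + 1"
proof -
  have "(adjacency G)\<^sup>* \<inter> verts G \<times> verts G = verts G \<times> verts G"
    using assms unfolding connected_mgraph_def by auto
  moreover have "verts G // (verts G \<times> verts G) = {verts G}"
    using assms unfolding connected_mgraph_def quotient_def by auto
  ultimately show ?thesis unfolding nullity_def components_def by simp
qed

subsection \<open>Contraction-invariant degree sums\<close>

definition theta :: "(nat \<Rightarrow> real) \<Rightarrow> ('v, 'e) mgraph \<Rightarrow> real" where
  "theta f G = (\<Sum>s\<in>Pow (edges G). \<Prod>v\<in>verts G. f (sdeg G s v))"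

text \<open>The edges parallel to \<open>e\<close> survive as loops at \<open>u\<close>, so
  contracting a non-loop keeps the nullity.\<close>

definition contract :: "('v, 'e) mgraph \<Rightarrow> 'e \<Rightarrow> 'v \<Rightarrow> 'v \<Rightarrow> ('v, 'e) mgraph" where
  "contract G e u v =
     \<lparr>verts = verts G - {v}, edges = edges G - {e},
      ends = (\<lambda>x. image_mset (\<lambda>y. if y = v then u else y) (ends G x))\<rparr>"

lemma count_image_merge:
  "count (image_mset (\<lambda>y. if y = v then u else y) M) x =
     (if x = u then if u = v then count M u else count M u + count M v
      else if x = v then 0 else count M x)"
  by (induction M) auto

lemma sdeg_contract:
  assumes "u \<noteq> v"
  shows "sdeg (contract G e u v) s x =
    (if x = u then sdeg G s u + sdeg G s v else if x = v then 0 else sdeg G s x)"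
  using assms unfolding sdeg_eq_sum contract_def by (simp add: count_image_merge sum.distrib)

lemma sum_Pow_remove:
  assumes "finite E" "e \<in> E"
  shows "sum t (Pow E) = (\<Sum>s\<in>Pow (E - {e}). t s + t (insert e s) :: real)"
proof -
  have "Pow E = Pow (E - {e}) \<union> insert e ` Pow (E - {e})"
    using assms(2) by (metis Pow_insert insert_Diff)
  moreover have "Pow (E - {e}) \<inter> insert e ` Pow (E - {e}) = {}" by auto
  moreover have "inj_on (insert e) (Pow (E - {e}))"
    by (auto simp: inj_on_def)
  ultimately show ?thesis using assms(1)
    by (simp add: sum.union_disjoint sum.reindex sum.distrib)
qed

text \<open>Subsets of \<open>edges G\<close> come in pairs \<open>s\<close>,
  \<open>insert e s\<close> with \<open>e\<close> not in \<open>s\<close>. If \<open>u\<close> and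
  \<open>v\<close> have degrees a and b in \<open>s\<close>, the merged vertex has degree a + b,
  while adding \<open>e\<close> raises a and b by one each. The assumption on \<open>f\<close> is
  thus exactly the statement that each pair contributes what \<open>s\<close> contributes after
  contraction.\<close>

lemma theta_contract:
  assumes G: "finite_multigraph G" and e: "e \<in> edges G" "ends G e = {#u, v#}" "u \<noteq> v"
    and f: "\<And>a b. f a * f b + f (Suc a) * f (Suc b) = f (a + b)"
  shows "theta f (contract G e u v) = theta f G"
proof -
  note fin = finite_multigraphD(1,2)[OF G]
  have uv: "u \<in> verts G" "v \<in> verts G" using finite_multigraphD(4)[OF G e(1)] e(2) by auto
  define W where "W = verts G - {u, v}"
  have V: "verts G = insert u (insert v W)" and V': "verts G - {v} = insert u W"
    and W: "finite W" "u \<notin> W" "v \<notin> W"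
    using uv fin e(3) by (auto simp: W_def)
  have "theta f (contract G e u v) =
      (\<Sum>s\<in>Pow (edges G - {e}). \<Prod>x\<in>insert u W. f (sdeg (contract G e u v) s x))"
    unfolding theta_def by (simp add: contract_def V')
  also have "\<dots> = (\<Sum>s\<in>Pow (edges G - {e}).
      (\<Prod>x\<in>verts G. f (sdeg G s x)) + (\<Prod>x\<in>verts G. f (sdeg G (insert e s) x)))"
  proof (rule sum.cong[OF refl])
    fix s assume "s \<in> Pow (edges G - {e})"
    then have s: "finite s" "e \<notin> s" using fin(2) by (auto intro: finite_subset)
    have ins: "sdeg G (insert e s) x =
        (if x = u \<or> x = v then Suc (sdeg G s x) else sdeg G s x)" for x
      using sdeg_insert[OF s, of G x] e by auto
    have "(\<Prod>x\<in>insert u W. f (sdeg (contract G e u v) s x)) =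
        f (sdeg G s u + sdeg G s v) * (\<Prod>x\<in>W. f (sdeg G s x))"
      using W e(3) by (auto simp: sdeg_contract intro!: prod.cong)
    also have "\<dots> = f (sdeg G s u) * f (sdeg G s v) * (\<Prod>x\<in>W. f (sdeg G s x))
        + f (Suc (sdeg G s u)) * f (Suc (sdeg G s v)) * (\<Prod>x\<in>W. f (sdeg G s x))"
      by (simp add: f[symmetric] algebra_simps)
    also have "f (Suc (sdeg G s u)) * f (Suc (sdeg G s v)) * (\<Prod>x\<in>W. f (sdeg G s x)) =
        (\<Prod>x\<in>verts G. f (sdeg G (insert e s) x))"
    proof -
      have "(\<Prod>x\<in>W. f (sdeg G s x)) = (\<Prod>x\<in>W. f (sdeg G (insert e s) x))"
        using W by (intro prod.cong) (auto simp: ins)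
      then show ?thesis unfolding V using W e(3) by (simp add: ins)
    qed
    also have "f (sdeg G s u) * f (sdeg G s v) * (\<Prod>x\<in>W. f (sdeg G s x)) =
        (\<Prod>x\<in>verts G. f (sdeg G s x))"
      unfolding V using W e(3) by simp
    finally show "(\<Prod>x\<in>insert u W. f (sdeg (contract G e u v) s x)) =
        (\<Prod>x\<in>verts G. f (sdeg G s x)) + (\<Prod>x\<in>verts G. f (sdeg G (insert e s) x))" .
  qed
  also have "\<dots> = theta f G"
    unfolding theta_def using sum_Pow_remove[OF fin(2) e(1)] by simp
  finally show ?thesis .
qed

lemma finite_multigraph_contract:
  assumes "finite_multigraph G" "u \<in> verts G" "u \<noteq> v"
  shows "finite_multigraph (contract G e u v)"
  using assms unfolding finite_multigraph_def multigraph_def contract_def by auto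

lemma connected_contract:
  assumes "connected_mgraph G" "e \<in> edges G" "ends G e = {#u, v#}" "u \<in> verts G" "u \<noteq> v"
  shows "connected_mgraph (contract G e u v)"
proof (rule connected_retract[OF assms(1), where r = "\<lambda>y. if y = v then u else y"])
  fix e' x y assume e': "e' \<in> edges G" "ends G e' = {#x, y#}"
  show "(if x = v then u else x, if y = v then u else y) \<in> (adjacency (contract G e u v))\<^sup>*"
  proof (cases "e' = e")
    case True
    then have "{#x, y#} = {#u, v#}" using e' assms(3) by simp
    then show ?thesis by (auto simp: add_eq_conv_ex)
  next
    case False
    then show ?thesis using e' by (intro adjacency_edge[of e']) (auto simp: contract_def)
  qed
qed (use assms in \<open>auto simp: contract_def\<close>)

lemma single_vertex_loop:
  assumes "finite_multigraph G" "verts G = {v}" "e \<in> edges G"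
  shows "ends G e = {#v, v#}"
proof -
  have M: "size (ends G e) = 2" "set_mset (ends G e) \<subseteq> {v}"
    using assms unfolding finite_multigraph_def multigraph_def by auto
  then have "v \<in># ends G e"
    by (metis multiset_nonemptyE singletonD size_empty subsetD zero_neq_numeral)
  then obtain x where x: "ends G e = {#v, x#}" using size_two_witness[OF M(1)] by blast
  with M(2) show ?thesis by simp
qed

lemma single_vertex_sdeg:
  assumes "finite_multigraph G" "verts G = {v}" "s \<subseteq> edges G"
  shows "sdeg G s v = 2 * card s"
proof -
  have "(\<Sum>e\<in>s. count (ends G e) v) = (\<Sum>e\<in>s. 2)"
    using single_vertex_loop[OF assms(1,2)] assms(3) by (intro sum.cong) auto
  then show ?thesis by (simp add: sdeg_eq_sum)
qed

text \<open>Contracting non-loops until one vertex is left lowers vertex and edge numbers equally,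
  and at a single vertex every edge is a loop and counts twice. The number \<open>n\<close> is the
  nullity, given by an additive equation to avoid subtraction of natural numbers.\<close>

lemma theta_connected:
  assumes "finite_multigraph G" "connected_mgraph G"
    and f: "\<And>a b. f a * f b + f (Suc a) * f (Suc b) = f (a + b)"
  shows "\<exists>n. card (edges G) + 1 = n + card (verts G) \<and>
    theta f G = (\<Sum>s\<in>Pow {..<n}. f (2 * card s))"
  using assms(1,2)
proof (induction "card (verts G)" arbitrary: G rule: less_induct)
  case less
  note fin = finite_multigraphD(1,2)[OF less.prems(1)]
  obtain v where v: "v \<in> verts G" using less.prems(2) unfolding connected_mgraph_def by auto
  show ?case
  proof (cases "verts G = {v}")
    case True
    define n where "n = card (edges G)"
    then obtain h where h: "bij_betw h (edges G) {..<n}"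
      using fin(2) by (metis card_lessThan finite_lessThan finite_same_card_bij)
    have "theta f G = (\<Sum>s\<in>Pow (edges G). f (2 * card s))"
      unfolding theta_def using single_vertex_sdeg[OF less.prems(1) True]
      by (intro sum.cong) (auto simp: True)
    also have "\<dots> = (\<Sum>s\<in>Pow {..<n}. f (2 * card s))"
    proof -
      have "card s = card (h ` s)" if "s \<in> Pow (edges G)" for s
        using that h by (metis PowD bij_betw_def card_image inj_on_subset)
      then have "(\<Sum>s\<in>Pow (edges G). f (2 * card s)) = (\<Sum>s\<in>Pow (edges G). f (2 * card (h ` s)))"
        by (intro sum.cong) auto
      also have "\<dots> = (\<Sum>s\<in>Pow {..<n}. f (2 * card s))"
        by (rule sum.reindex_bij_betw[OF bij_betw_Pow[OF h]])
      finally show ?thesis .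
    qed
    finally show ?thesis using True n_def by auto
  next
    case False
    then obtain w where "w \<in> verts G" "v \<noteq> w" using v by auto
    then obtain e u where e: "e \<in> edges G" "ends G e = {#v, u#}" "u \<noteq> v" "u \<in> verts G"
      using connected_nonloop[OF less.prems(1,2) v] by metis
    have cards: "card (verts (contract G e v u)) = card (verts G) - 1" "card (verts G) > 0"
      "card (edges (contract G e v u)) = card (edges G) - 1" "card (edges G) > 0"
      using fin e v by (auto simp: contract_def card_gt_0_iff)
    have "\<exists>n. card (edges (contract G e v u)) + 1 = n + card (verts (contract G e v u)) \<and>
        theta f (contract G e v u) = (\<Sum>s\<in>Pow {..<n}. f (2 * card s))"
      using cards e v
      by (intro less.hyps finite_multigraph_contract connected_contract less.prems(1,2)) auto
    moreover have "theta f (contract G e v u) = theta f G"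
      using theta_contract[OF less.prems(1) e(1,2) _ f] e(3) by simp
    moreover have "card (verts G) \<ge> 2" using cards(1,2) e v fin(1)
      by (metis One_nat_def Suc_1 Suc_leI card_le_Suc0_iff_eq not_less_eq_eq)
    ultimately show ?thesis using cards by auto
  qed
qed

lemma sum_Pow_power_card:
  assumes "finite E"
  shows "(\<Sum>s\<in>Pow E. x ^ card s) = (1 + x :: real) ^ card E"
  using assms
proof (induction E)
  case (insert e E)
  have "(\<Sum>s\<in>Pow (insert e E). x ^ card s) = (\<Sum>s\<in>Pow E. x ^ card s + x ^ card (insert e s))"
    using sum_Pow_remove[of "insert e E" e "\<lambda>s. x ^ card s"] insert.hyps by simp
  also have "\<dots> = (\<Sum>s\<in>Pow E. (1 + x) * x ^ card s)"
  proof (rule sum.cong[OF refl])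
    fix s assume "s \<in> Pow E"
    then have "finite s" "e \<notin> s" using insert.hyps by (auto intro: finite_subset)
    then show "x ^ card s + x ^ card (insert e s) = (1 + x) * x ^ card s"
      by (simp add: algebra_simps)
  qed
  also have "\<dots> = (1 + x) * (1 + x) ^ card E"
    using insert.IH by (metis sum_distrib_left)
  finally show ?case using insert.hyps by simp
qed simp

section \<open>The two weights and their totals\<close>

definition even_weight :: "nat \<Rightarrow> real" where
  "even_weight n = (if even n then 1 else 0)"

text \<open>The value at n is the Fibonacci number of index n - 1, continued to index -1. The shift
  puts the zero at 1, the forbidden degree, and the values at 0, 2 and 3 are all 1.\<close>

fun fib_weight :: "nat \<Rightarrow> real" where
  "fib_weight 0 = 1"
| "fib_weight (Suc 0) = 0"
| "fib_weight (Suc (Suc n)) = fib_weight (Suc n) + fib_weight n"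

lemma even_weight_convolution:
  "even_weight a * even_weight b + even_weight (Suc a) * even_weight (Suc b) = even_weight (a + b)"
  by (auto simp: even_weight_def)

text \<open>For fixed \<open>b\<close> both sides satisfy the Fibonacci recurrence in
  \<open>a\<close>, and they agree at \<open>a = 0\<close> and \<open>a = 1\<close>.\<close>

lemma fib_weight_convolution:
  "fib_weight a * fib_weight b + fib_weight (Suc a) * fib_weight (Suc b) = fib_weight (a + b)"
  by (induction a rule: fib_weight.induct) (auto simp: algebra_simps)

lemma fib_weight_nonneg: "fib_weight n \<ge> 0"
  by (induction n rule: fib_weight.induct) auto

lemma fib_weight_ge_1: "n \<noteq> 1 \<Longrightarrow> fib_weight n \<ge> 1"
proof (induction n rule: fib_weight.induct)
  case (3 n)
  then show ?case using fib_weight_nonneg[of n] by (cases n) auto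
qed auto

text \<open>The first value above 1 occurs at 4, which is the source of the degree bound 3 in the
  equality case of the upper bound.\<close>

lemma fib_weight_gt_1: "n \<ge> 4 \<Longrightarrow> fib_weight n > 1"
proof -
  assume "n \<ge> 4"
  then obtain m where "n = Suc (Suc m)" "m \<ge> 2"
    by (intro that[of "n - 2"]) auto
  then show ?thesis using fib_weight_ge_1[of m] fib_weight_ge_1[of "Suc m"] by simp
qed

text \<open>Binet's formula at index n - 1. The two roots p, q of x^2 = x + 1 have product -1, so
  1/p = -q and 1/q = -p; this rewriting avoids negative exponents at n = 0.\<close>

lemma fib_weight_closed_form:
  "sqrt 5 * fib_weight n =
     (1 + sqrt 5) / 2 * ((1 - sqrt 5) / 2) ^ n - (1 - sqrt 5) / 2 * ((1 + sqrt 5) / 2) ^ n"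
proof (induction n rule: fib_weight.induct)
  case (3 n)
  define p q where pq: "p = (1 + sqrt 5) / 2" "q = (1 - sqrt 5) / 2"
  have sq: "p * p = p + 1" "q * q = q + 1" by (simp_all add: pq field_simps)
  have "p ^ Suc (Suc n) = p ^ Suc n + p ^ n" "q ^ Suc (Suc n) = q ^ Suc n + q ^ n"
    using sq by (metis (no_types, opaque_lifting) mult.assoc distrib_right mult_1 power_Suc)+
  then show ?case using 3 unfolding pq[symmetric] fib_weight.simps(3) distrib_left
    by (simp only: distrib_left)
qed (auto simp: field_simps)

text \<open>By the closed form the sum splits into two sums of x ^ \<open>card s\<close> over all
  subsets, with x the square of a root, and each is (1 + x) ^ n.\<close>

lemma fib_weight_sum:
  "(\<Sum>s\<in>Pow {..<n}. fib_weight (2 * card s)) =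
     ((5 - sqrt 5) / 2) powi (int n - 1) + ((5 + sqrt 5) / 2) powi (int n - 1)"
proof -
  define p q where pq: "p = (1 + sqrt 5) / 2" "q = (1 - sqrt 5) / 2"
  have s5: "sqrt 5 < (5::real)" "sqrt 5 > (0 :: real)"
    by (auto intro: real_less_lsqrt)
  have sq: "1 + p\<^sup>2 = (5 + sqrt 5) / 2" "1 + q\<^sup>2 = (5 - sqrt 5) / 2"
    by (simp_all add: pq power2_eq_square field_simps)
  \<comment> \<open>Each coefficient absorbs one factor of its power and leaves the same constant
    \<open>sqrt 5\<close>; hence the exponent n - 1.\<close>
  have inv: "p * ((5 - sqrt 5) / 2) = sqrt 5" "- q * ((5 + sqrt 5) / 2) = sqrt 5"
    by (simp_all add: pq field_simps)
  have "sqrt 5 * (\<Sum>s\<in>Pow {..<n}. fib_weight (2 * card s)) =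
      (\<Sum>s\<in>Pow {..<n}. p * (q\<^sup>2) ^ card s - q * (p\<^sup>2) ^ card s)"
    unfolding sum_distrib_left
    by (intro sum.cong refl) (simp add: fib_weight_closed_form pq power_mult)
  also have "\<dots> = p * ((5 - sqrt 5) / 2) ^ n + (- q) * ((5 + sqrt 5) / 2) ^ n"
    using sum_Pow_power_card[of "{..<n}" "q\<^sup>2"] sum_Pow_power_card[of "{..<n}" "p\<^sup>2"]
    by (simp add: sum_subtractf sum_distrib_left[symmetric] sq)
  also have "\<dots> = sqrt 5 *
      (((5 - sqrt 5) / 2) powi (int n - 1) + ((5 + sqrt 5) / 2) powi (int n - 1))"
  proof -
    \<comment> \<open>For \<open>n = 0\<close> the exponent is -1, so \<open>x\<close> has to be
      nonzero.\<close>
    have pow: "x ^ n = x * x powi (int n - 1)" if "x \<noteq> 0" for x :: real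
      using that by (simp add: power_int_diff)
    have "0 < (5 - sqrt 5) / 2" using s5(1) by simp
    moreover have "0 < (5 + sqrt 5) / 2" by (simp add: add_pos_pos)
    ultimately have "0 < (5 - sqrt 5) / 2" "0 < (5 + sqrt 5) / 2" by blast+
    from this[THEN less_imp_neq, THEN not_sym, THEN pow]
    have "p * ((5 - sqrt 5) / 2) ^ n = p * ((5 - sqrt 5) / 2) * ((5 - sqrt 5) / 2) powi (int n - 1)"
      "- q * ((5 + sqrt 5) / 2) ^ n = - q * ((5 + sqrt 5) / 2) * ((5 + sqrt 5) / 2) powi (int n - 1)"
      by (simp_all only: mult.assoc)
    then show ?thesis unfolding inv by (simp add: distrib_left)
  qed
  finally show ?thesis using s5 by simp
qed

section \<open>Comparison of the number of sub-coregraphs with the two totals\<close>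

lemma sum_le_eq_iff:
  fixes g h :: "'a \<Rightarrow> real"
  assumes "finite A" "\<And>x. x \<in> A \<Longrightarrow> g x \<le> h x"
  shows "sum g A = sum h A \<longleftrightarrow> (\<forall>x\<in>A. g x = h x)"
proof -
  have "sum g A = sum h A \<longleftrightarrow> (\<Sum>x\<in>A. h x - g x) = 0"
    by (auto simp: sum_subtractf)
  also have "\<dots> \<longleftrightarrow> (\<forall>x\<in>A. h x - g x = 0)"
    using assms by (intro sum_nonneg_eq_0_iff) auto
  finally show ?thesis by auto
qed

lemma card_sub_coregraphs:
  assumes "finite_multigraph G"
  shows "real (card (sub_coregraphs G)) = (\<Sum>s\<in>Pow (edges G). of_bool (s \<in> sub_coregraphs G))"
proof -
  have "sub_coregraphs G \<subseteq> Pow (edges G)" by (auto simp: sub_coregraphs_def)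
  then have "Pow (edges G) \<inter> {s. s \<in> sub_coregraphs G} = sub_coregraphs G" by auto
  then show ?thesis
    using finite_multigraphD(2)[OF assms] by (simp add: sum.If_cases of_bool_def)
qed

text \<open>The product of the weights is the indicator that all degrees are even. As 1 is odd, an
  edge set with all degrees even is a sub-coregraph, so the total counts a subset of the
  sub-coregraphs.\<close>

lemma theta_even_weight:
  assumes "finite_multigraph G"
  shows "theta even_weight G \<le> real (card (sub_coregraphs G))"
    and "theta even_weight G = real (card (sub_coregraphs G)) \<longleftrightarrow>
      (\<forall>s\<in>sub_coregraphs G. \<forall>v\<in>verts G. even (sdeg G s v))"
proof -
  note fin = finite_multigraphD(1,2)[OF assms]
  have prod: "(\<Prod>v\<in>verts G. even_weight (sdeg G s v)) = of_bool (\<forall>v\<in>verts G. even (sdeg G s v))" for s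
    using fin(1) by (auto simp: even_weight_def intro!: prod_zero)
  have le: "of_bool (\<forall>v\<in>verts G. even (sdeg G s v)) \<le> (of_bool (s \<in> sub_coregraphs G) :: real)"
    if "s \<in> Pow (edges G)" for s
    using that by (auto simp: sub_coregraphs_def of_bool_def)
  show "theta even_weight G \<le> real (card (sub_coregraphs G))"
    unfolding theta_def prod card_sub_coregraphs[OF assms] using le by (rule sum_mono)
  have "theta even_weight G = real (card (sub_coregraphs G)) \<longleftrightarrow>
      (\<forall>s\<in>Pow (edges G). of_bool (\<forall>v\<in>verts G. even (sdeg G s v)) = (of_bool (s \<in> sub_coregraphs G) :: real))"
    unfolding theta_def prod card_sub_coregraphs[OF assms] using fin(2) le by (intro sum_le_eq_iff) auto
  also have "\<dots> \<longleftrightarrow> (\<forall>s\<in>Pow (edges G). (\<forall>v\<in>verts G. even (sdeg G s v)) \<longleftrightarrow> s \<in> sub_coregraphs G)"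
    by (simp only: of_bool_eq_iff)
  also have "\<dots> \<longleftrightarrow> (\<forall>s\<in>sub_coregraphs G. \<forall>v\<in>verts G. even (sdeg G s v))"
  proof -
    have "s \<in> sub_coregraphs G" if "s \<in> Pow (edges G)" "\<forall>v\<in>verts G. even (sdeg G s v)" for s
      using that unfolding sub_coregraphs_def by fastforce
    moreover have "sub_coregraphs G \<subseteq> Pow (edges G)" by (auto simp: sub_coregraphs_def)
    ultimately show ?thesis by blast
  qed
  finally show "theta even_weight G = real (card (sub_coregraphs G)) \<longleftrightarrow>
      (\<forall>s\<in>sub_coregraphs G. \<forall>v\<in>verts G. even (sdeg G s v))" .
qed

text \<open>A degree 1 makes both sides vanish. Otherwise every factor is at least 1, so the product
  is 1 iff every factor is 1, that is, iff no degree reaches 4.\<close>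

lemma prod_fib_weight:
  assumes "finite V"
  shows "of_bool (\<forall>v\<in>V. d v \<noteq> 1) \<le> (\<Prod>v\<in>V. fib_weight (d v))"
    and "(\<Prod>v\<in>V. fib_weight (d v)) = of_bool (\<forall>v\<in>V. d v \<noteq> 1) \<longleftrightarrow>
      ((\<forall>v\<in>V. d v \<noteq> 1) \<longrightarrow> (\<forall>v\<in>V. d v \<le> 3))"
proof -
  have "of_bool (\<forall>v\<in>V. d v \<noteq> 1) \<le> (\<Prod>v\<in>V. fib_weight (d v)) \<and>
    ((\<Prod>v\<in>V. fib_weight (d v)) = of_bool (\<forall>v\<in>V. d v \<noteq> 1) \<longleftrightarrow>
      ((\<forall>v\<in>V. d v \<noteq> 1) \<longrightarrow> (\<forall>v\<in>V. d v \<le> 3)))"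
  proof (cases "\<forall>v\<in>V. d v \<noteq> 1")
    case False
    then obtain v where "v \<in> V" "d v = 1" by blast
    then have "(\<Prod>v\<in>V. fib_weight (d v)) = 0" using assms by (auto intro!: prod_zero bexI[of _ v])
    with False show ?thesis by auto
  next
    case True
    have ge: "(\<Prod>v\<in>W. fib_weight (d v)) \<ge> 1" if "W \<subseteq> V" for W
      using that True fib_weight_ge_1 by (intro prod_ge_1) blast
    have "(\<Prod>v\<in>V. fib_weight (d v)) = 1 \<longleftrightarrow> (\<forall>v\<in>V. d v \<le> 3)"
    proof
      assume *: "(\<Prod>v\<in>V. fib_weight (d v)) = 1"
      show "\<forall>v\<in>V. d v \<le> 3"
      proof (rule ccontr)
        assume "\<not> ?thesis"
        then obtain v where v: "v \<in> V" "d v \<ge> 4" by force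
        have "(\<Prod>v\<in>V. fib_weight (d v)) = fib_weight (d v) * (\<Prod>v\<in>V - {v}. fib_weight (d v))"
          using v assms by (simp add: prod.remove)
        moreover have "fib_weight (d v) * 1 \<le> fib_weight (d v) * (\<Prod>v\<in>V - {v}. fib_weight (d v))"
          using ge[of "V - {v}"] fib_weight_nonneg by (intro mult_left_mono) auto
        ultimately show False using fib_weight_gt_1[OF v(2)] * by simp
      qed
    next
      assume *: "\<forall>v\<in>V. d v \<le> 3"
      show "(\<Prod>v\<in>V. fib_weight (d v)) = 1"
      proof (rule prod.neutral, rule ballI)
        fix v assume "v \<in> V"
        then have "d v \<in> {0, 2, 3}" using * True by force
        then show "fib_weight (d v) = 1" by (auto simp: numeral_eq_Suc)
      qed
    qed
    then show ?thesis using True ge[of V] by auto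
  qed
  then show "of_bool (\<forall>v\<in>V. d v \<noteq> 1) \<le> (\<Prod>v\<in>V. fib_weight (d v))"
    "(\<Prod>v\<in>V. fib_weight (d v)) = of_bool (\<forall>v\<in>V. d v \<noteq> 1) \<longleftrightarrow>
      ((\<forall>v\<in>V. d v \<noteq> 1) \<longrightarrow> (\<forall>v\<in>V. d v \<le> 3))" by blast+
qed

lemma theta_fib_weight:
  assumes "finite_multigraph G"
  shows "real (card (sub_coregraphs G)) \<le> theta fib_weight G"
    and "real (card (sub_coregraphs G)) = theta fib_weight G \<longleftrightarrow>
      (\<forall>s\<in>sub_coregraphs G. \<forall>v\<in>verts G. sdeg G s v \<le> 3)"
proof -
  note fin = finite_multigraphD(1,2)[OF assms]
  have mem: "s \<in> sub_coregraphs G \<longleftrightarrow> (\<forall>v\<in>verts G. sdeg G s v \<noteq> 1)" if "s \<in> Pow (edges G)" for s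
    using that by (auto simp: sub_coregraphs_def)
  have le: "(of_bool (s \<in> sub_coregraphs G) :: real) \<le> (\<Prod>v\<in>verts G. fib_weight (sdeg G s v))"
    if "s \<in> Pow (edges G)" for s
    unfolding mem[OF that] by (rule prod_fib_weight(1)[OF fin(1)])
  show "real (card (sub_coregraphs G)) \<le> theta fib_weight G"
    unfolding theta_def card_sub_coregraphs[OF assms] using le by (rule sum_mono)
  have "real (card (sub_coregraphs G)) = theta fib_weight G \<longleftrightarrow>
      (\<forall>s\<in>Pow (edges G). of_bool (s \<in> sub_coregraphs G) = (\<Prod>v\<in>verts G. fib_weight (sdeg G s v)))"
    unfolding theta_def card_sub_coregraphs[OF assms] using fin(2) le by (intro sum_le_eq_iff) auto
  also have "\<dots> \<longleftrightarrow> (\<forall>s\<in>Pow (edges G). s \<in> sub_coregraphs G \<longrightarrow> (\<forall>v\<in>verts G. sdeg G s v \<le> 3))"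
  proof (intro ball_cong refl)
    fix s assume s: "s \<in> Pow (edges G)"
    show "of_bool (s \<in> sub_coregraphs G) = (\<Prod>v\<in>verts G. fib_weight (sdeg G s v)) \<longleftrightarrow>
        (s \<in> sub_coregraphs G \<longrightarrow> (\<forall>v\<in>verts G. sdeg G s v \<le> 3))"
      unfolding mem[OF s] using prod_fib_weight(2)[OF fin(1), of "sdeg G s"] by (simp only: eq_commute)
  qed
  also have "\<dots> \<longleftrightarrow> (\<forall>s\<in>sub_coregraphs G. \<forall>v\<in>verts G. sdeg G s v \<le> 3)"
    by (auto simp: sub_coregraphs_def)
  finally show "real (card (sub_coregraphs G)) = theta fib_weight G \<longleftrightarrow>
      (\<forall>s\<in>sub_coregraphs G. \<forall>v\<in>verts G. sdeg G s v \<le> 3)" .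
qed

lemma sub_coregraphs_bounds:
  assumes G: "finite_multigraph G" "connected_mgraph G"
  defines "upper \<equiv> ((5 - sqrt 5) / 2) powi (nullity G - 1) + ((5 + sqrt 5) / 2) powi (nullity G - 1)"
  shows "2 powi (nullity G) \<le> real (card (sub_coregraphs G))"
    and "real (card (sub_coregraphs G)) \<le> upper"
    and "real (card (sub_coregraphs G)) = 2 powi (nullity G) \<longleftrightarrow>
      (\<forall>s\<in>sub_coregraphs G. \<forall>v\<in>verts G. even (sdeg G s v))"
    and "real (card (sub_coregraphs G)) = upper \<longleftrightarrow>
      (\<forall>s\<in>sub_coregraphs G. \<forall>v\<in>verts G. sdeg G s v \<le> 3)"
proof -
  obtain n where n: "card (edges G) + 1 = n + card (verts G)"
    "theta even_weight G = (\<Sum>s\<in>Pow {..<n}. even_weight (2 * card s))"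
    using theta_connected[OF G, of even_weight] even_weight_convolution by blast
  obtain m where m: "card (edges G) + 1 = m + card (verts G)"
    "theta fib_weight G = (\<Sum>s\<in>Pow {..<m}. fib_weight (2 * card s))"
    using theta_connected[OF G, of fib_weight] fib_weight_convolution by blast
  have null: "nullity G = int n" "m = n" using n(1) m(1) nullity_connected[OF G(2)] by linarith+
  \<comment> \<open>On a bouquet all degrees are even, so each of the \<open>2 ^ n\<close> edge sets
    contributes 1.\<close>
  have "theta even_weight G = 2 powi (nullity G)"
    unfolding n(2) null by (simp add: even_weight_def card_Pow)
  moreover have "theta fib_weight G = upper"
    unfolding m(2) upper_def null by (rule fib_weight_sum)
  ultimately show "2 powi (nullity G) \<le> real (card (sub_coregraphs G))"
    "real (card (sub_coregraphs G)) \<le> upper"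
    "real (card (sub_coregraphs G)) = 2 powi (nullity G) \<longleftrightarrow>
      (\<forall>s\<in>sub_coregraphs G. \<forall>v\<in>verts G. even (sdeg G s v))"
    "real (card (sub_coregraphs G)) = upper \<longleftrightarrow>
      (\<forall>s\<in>sub_coregraphs G. \<forall>v\<in>verts G. sdeg G s v \<le> 3)"
    using theta_even_weight[OF G(1)] theta_fib_weight[OF G(1)] by metis+
qed

subsection \<open>Leaf deletion and cycles\<close>

text \<open>A sum of natural numbers equal to 1 has one summand 1 and all others 0; the multiplicity
  1 also rules out a loop.\<close>

lemma leaf_edge:
  assumes "finite_multigraph G" "degree G v = 1" "e \<in> edges G" "v \<in># ends G e"
  obtains u where "ends G e = {#v, u#}" "u \<noteq> v" "u \<in> verts G"
    "\<And>e'. e' \<in> edges G \<Longrightarrow> e' \<noteq> e \<Longrightarrow> v \<notin># ends G e'"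
proof -
  have "\<exists>a\<in>edges G. count (ends G a) v = 1 \<and> (\<forall>b\<in>edges G. a \<noteq> b \<longrightarrow> count (ends G b) v = 0)"
    using assms(2) finite_multigraphD(2)[OF assms(1)] unfolding degree_def
    by (metis (no_types, lifting) sum_eq_1_iff)
  then have 1: "count (ends G e) v = 1" "\<And>e'. e' \<in> edges G \<Longrightarrow> e' \<noteq> e \<Longrightarrow> v \<notin># ends G e'"
    using assms(3,4) by (metis not_in_iff)+
  obtain u where u: "ends G e = {#v, u#}"
    using size_two_witness[OF finite_multigraphD(3)[OF assms(1,3)] assms(4)] .
  moreover have "u \<noteq> v" using u 1(1) by auto
  moreover have "u \<in> verts G" using finite_multigraphD(4)[OF assms(1,3)] u by auto
  ultimately show thesis using 1(2) that by blast
qed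

text \<open>In a cycle of length one the edge is a loop at \<open>v\<close>; in a longer one the
  edge that starts at \<open>v\<close> and the edge before it are distinct. This keeps cycles away
  from vertices of degree one.\<close>

lemma cycle_two_edges:
  assumes "is_cycle G vs es" "v \<in> set vs"
  shows "(\<exists>e\<in>set es. ends G e = {#v, v#}) \<or>
    (\<exists>e\<in>set es. \<exists>e'\<in>set es. e \<noteq> e' \<and> v \<in># ends G e \<and> v \<in># ends G e')"
proof -
  have c: "length vs = length es" "distinct es"
    "\<And>i. i < length es \<Longrightarrow> ends G (es ! i) = {#vs ! i, vs ! (Suc i mod length vs)#}"
    using assms(1) unfolding is_cycle_def by auto
  obtain i where i: "i < length es" "vs ! i = v" using assms(2) c(1) by (metis in_set_conv_nth)
  show ?thesis
  proof (cases "length es = 1")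
    case True
    then have "ends G (es ! i) = {#v, v#}" using c(3)[OF i(1)] i c(1) by simp
    then show ?thesis using i(1) by (metis nth_mem)
  next
    case False
    \<comment> \<open>The cyclic predecessor of \<open>i\<close>, different from \<open>i\<close>
      because the length is at least 2.\<close>
    define j where "j = (if i = 0 then length es - 1 else i - 1)"
    have j: "j < length es" "j \<noteq> i" "Suc j mod length vs = i"
      using i(1) False c(1) by (auto simp: j_def)
    have "v \<in># ends G (es ! i)" "v \<in># ends G (es ! j)"
      using c(3)[OF i(1)] c(3)[OF j(1)] i(2) j(3) by auto
    moreover have "es ! i \<noteq> es ! j" using j i c(2) by (simp add: nth_eq_iff_index_eq)
    ultimately show ?thesis using i(1) j(1) by (meson nth_mem)
  qed
qed

text \<open>One vertex and one edge disappear together, which preserves the nullity. A sub-coregraph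
  cannot contain the leaf edge, since the leaf would have degree one in it, and a cycle cannot visit
  the leaf. So the bounds may be studied on the core.\<close>

lemma delete_leaf_invariants:
  assumes G: "finite_multigraph G" "connected_mgraph G" and H: "delete_leaf G H"
  shows "finite_multigraph H \<and> connected_mgraph H \<and> nullity H = nullity G \<and>
    sub_coregraphs H = sub_coregraphs G \<and> (\<forall>vs es. is_cycle H vs es \<longleftrightarrow> is_cycle G vs es)"
proof -
  obtain v e where v: "v \<in> verts G" "degree G v = 1" "e \<in> edges G" "v \<in># ends G e"
    and H_def: "H = G\<lparr>verts := verts G - {v}, edges := edges G - {e}\<rparr>"
    using H unfolding delete_leaf_def by blast
  obtain u where u: "ends G e = {#v, u#}" "u \<noteq> v" "u \<in> verts G"
    and other: "\<And>e'. e' \<in> edges G \<Longrightarrow> e' \<noteq> e \<Longrightarrow> v \<notin># ends G e'"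
    using leaf_edge[OF G(1) v(2-4)] by metis
  note fin = finite_multigraphD(1,2)[OF G(1)]
  have fH: "finite_multigraph H"
    using G(1) other unfolding finite_multigraph_def multigraph_def H_def by auto
  have cH: "connected_mgraph H"
  proof (rule connected_retract[OF G(2), where r = "\<lambda>y. if y = v then u else y"])
    fix e' x y assume e': "e' \<in> edges G" "ends G e' = {#x, y#}"
    show "(if x = v then u else x, if y = v then u else y) \<in> (adjacency H)\<^sup>*"
    proof (cases "e' = e")
      case True
      then have "{#x, y#} = {#v, u#}" using e' u by simp
      then show ?thesis by (auto simp: add_eq_conv_ex)
    next
      case False
      then show ?thesis using e' other[OF e'(1)] by (intro adjacency_edge[of e']) (auto simp: H_def)
    qed
  qed (use u H_def in auto)
  have "card (verts G) > 0" "card (edges G) > 0" using v fin by (auto simp: card_gt_0_iff)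
  then have nH: "nullity H = nullity G"
    using v fin nullity_connected[OF G(2)] nullity_connected[OF cH] by (simp add: H_def of_nat_diff)
  have deg: "sdeg H s x = sdeg G s x" for s x by (simp add: H_def degree_def)
  have deg_v: "sdeg G s v = (if e \<in> s then 1 else 0)" if "s \<subseteq> edges G" for s
  proof -
    have "sdeg G t v = 0" if "t \<subseteq> edges G - {e}" for t
      unfolding sdeg_eq_sum using other that by (intro sum.neutral) (auto simp: not_in_iff)
    moreover have "finite s" using that fin by (auto intro: finite_subset)
    ultimately show ?thesis using that sdeg_remove[of s e G v] u
      by (cases "e \<in> s") (auto simp: subset_iff)
  qed
  have sH: "sub_coregraphs H = sub_coregraphs G"
  proof (rule set_eqI)
    fix s
    have "s \<in> sub_coregraphs G \<longleftrightarrow> s \<subseteq> edges G \<and> e \<notin> s \<and> (\<forall>x\<in>verts G - {v}. sdeg G s x \<noteq> 1)"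
      unfolding sub_coregraphs_def using deg_v[of s] v(1) by (auto split: if_splits)
    also have "\<dots> \<longleftrightarrow> s \<in> sub_coregraphs H"
      unfolding sub_coregraphs_def mem_Collect_eq deg by (auto simp: H_def)
    finally show "s \<in> sub_coregraphs H \<longleftrightarrow> s \<in> sub_coregraphs G" by simp
  qed
  have "is_cycle H vs es \<longleftrightarrow> is_cycle G vs es" for vs es
  proof
    assume "is_cycle H vs es"
    then show "is_cycle G vs es" unfolding is_cycle_def by (auto simp: H_def)
  next
    assume c: "is_cycle G vs es"
    then have es: "set es \<subseteq> edges G" unfolding is_cycle_def by blast
    have v_notin: "v \<notin> set vs"
    proof
      assume "v \<in> set vs"
      with cycle_two_edges[OF c this] show False
        using other es u by (metis add_mset_eq_single add_eq_conv_ex add_mset_commute subsetD union_single_eq_member add_mset_add_single)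
    qed
    \<comment> \<open>Both ends of an edge of a cycle lie on the cycle, so \<open>e\<close> would
      bring \<open>v\<close> with it.\<close>
    have "e \<notin> set es"
    proof
      assume "e \<in> set es"
      then obtain i where i: "i < length es" "es ! i = e" by (metis in_set_conv_nth)
      then have "ends G e = {#vs ! i, vs ! (Suc i mod length vs)#}" "i < length vs"
        using c unfolding is_cycle_def by auto
      moreover from this have "Suc i mod length vs < length vs" by (intro mod_less_divisor) auto
      ultimately have "v \<in> set vs" using v(4) by auto
      with v_notin show False by simp
    qed
    with v_notin c show "is_cycle H vs es" unfolding is_cycle_def by (auto simp: H_def)
  qed
  with fH cH nH sH show ?thesis by blast
qed

lemma delete_leaf_rtranclp_invariants:
  assumes "delete_leaf\<^sup>*\<^sup>* G H" "finite_multigraph G" "connected_mgraph G"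
  shows "finite_multigraph H \<and> connected_mgraph H \<and> nullity H = nullity G \<and>
    sub_coregraphs H = sub_coregraphs G \<and> (\<forall>vs es. is_cycle H vs es \<longleftrightarrow> is_cycle G vs es)"
  using assms(1)
proof induction
  case base
  with assms show ?case by simp
next
  case (step H1 H2)
  with delete_leaf_invariants[of H1 H2] show ?case by metis
qed

definition is_path :: "('v, 'e) mgraph \<Rightarrow> 'v list \<Rightarrow> 'e list \<Rightarrow> bool" where
  "is_path G vs es \<longleftrightarrow>
     length vs = Suc (length es) \<and> distinct vs \<and> distinct es \<and>
     set vs \<subseteq> verts G \<and> set es \<subseteq> edges G \<and>
     (\<forall>i<length es. ends G (es ! i) = {#vs ! i, vs ! Suc i#})"

text \<open>The first vertex of a longest path has an edge outside the path. By maximality its other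
  end is on the path, and the edge closes an initial segment of the path to a cycle.\<close>

lemma cycle_exists:
  assumes G: "finite_multigraph G" "verts G \<noteq> {}" and deg: "\<forall>v\<in>verts G. degree G v \<ge> 2"
  shows "\<exists>vs es. is_cycle G vs es"
proof -
  note fin = finite_multigraphD(1,2)[OF G(1)]
  obtain v0 where "v0 \<in> verts G" using G(2) by blast
  then have "is_path G [v0] []" by (simp add: is_path_def)
  \<comment> \<open>The vertices of a path are distinct, so lengths are bounded and a longest path
    exists.\<close>
  moreover have "\<forall>vs es. is_path G vs es \<longrightarrow> length vs < Suc (card (verts G))"
    unfolding is_path_def using fin(1) by (metis card_mono distinct_card less_Suc_eq_le)
  ultimately obtain vs es where p: "is_path G vs es"
    and max: "\<And>vs' es'. is_path G vs' es' \<Longrightarrow> length vs' \<le> length vs"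
    using ex_has_greatest_nat[of "\<lambda>vs. \<exists>es. is_path G vs es" "[v0]" length "Suc (card (verts G))"]
    by blast
  have p': "length vs = Suc (length es)" "distinct vs" "distinct es" "set vs \<subseteq> verts G" "set es \<subseteq> edges G"
    "\<And>i. i < length es \<Longrightarrow> ends G (es ! i) = {#vs ! i, vs ! Suc i#}"
    using p unfolding is_path_def by auto
  define v where "v = vs ! 0"
  have v: "v \<in> verts G" using p'(1,4) by (auto simp: v_def subset_iff)
  have inc: "i = 0" if "i < length es" "v \<in># ends G (es ! i)" for i
    using p'(6)[OF that(1)] that p'(1,2) by (auto simp: v_def nth_eq_iff_index_eq)
  \<comment> \<open>Of the path edges only the first meets \<open>v\<close>, and it contributes only
    1 to the degree, which is at least 2.\<close>
  have "\<exists>e\<in>edges G. v \<in># ends G e \<and> e \<notin> set es"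
  proof (rule ccontr)
    assume "\<not> ?thesis"
    then have all: "e \<in> set es" if "e \<in> edges G" "v \<in># ends G e" for e using that by blast
    have first: "es \<noteq> [] \<and> e = es ! 0" if "e \<in> edges G" "v \<in># ends G e" for e
      using all[OF that] inc that(2) by (metis in_set_conv_nth length_pos_if_in_set list.size(3) less_irrefl)
    show False
    proof (cases "es = []")
      case True
      then have "degree G v = 0" unfolding degree_def using first
        by (intro sum.neutral) (auto simp: count_eq_zero_iff)
      then show False using deg v by auto
    next
      case False
      then have e0: "ends G (es ! 0) = {#v, vs ! 1#}" "es ! 0 \<in> edges G" "vs ! 1 \<noteq> v"
        using p' by (auto simp: v_def subset_iff nth_eq_iff_index_eq)
      have "count (ends G b) v = 0" if "b \<in> edges G" "es ! 0 \<noteq> b" for b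
        using first[OF that(1)] that(2) by (metis count_eq_zero_iff)
      moreover have "count (ends G (es ! 0)) v = 1" using e0 by simp
      ultimately have "degree G v = 1" unfolding degree_def sum_eq_1_iff[OF fin(2)]
        using e0(2) by blast
      then show False using deg v by auto
    qed
  qed
  then obtain e where e: "e \<in> edges G" "v \<in># ends G e" "e \<notin> set es" by blast
  obtain x where x: "ends G e = {#v, x#}"
    using size_two_witness[OF finite_multigraphD(3)[OF G(1) e(1)] e(2)] .
  have xV: "x \<in> verts G" using finite_multigraphD(4)[OF G(1) e(1)] x by auto
  have "x \<in> set vs"
  proof (rule ccontr)
    assume "x \<notin> set vs"
    then have "is_path G (x # vs) (e # es)"
      using p' e xV x by (auto simp: is_path_def nth_Cons' v_def add_mset_commute)
    from max[OF this] show False by simp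
  qed
  then obtain j where j: "j < length vs" "vs ! j = x" by (metis in_set_conv_nth)
  \<comment> \<open>The edge \<open>e\<close> comes last and leads from the vertex at position
    \<open>j\<close> back to \<open>v\<close>. For \<open>j = 0\<close> it is a loop and the cycle
    has length one.\<close>
  have "is_cycle G (take (Suc j) vs) (take j es @ [e])"
    unfolding is_cycle_def
  proof (intro conjI allI impI)
    fix i assume "i < length (take j es @ [e])"
    then have "i < j \<or> i = j \<and> j < length es \<or> i = j \<and> j = length es" using j p'(1) by auto
    then show "ends G ((take j es @ [e]) ! i) =
        {#take (Suc j) vs ! i, take (Suc j) vs ! (Suc i mod length (take (Suc j) vs))#}"
      using p'(1,6) j x by (auto simp: nth_append v_def min_def add_mset_commute)
  qed (use p' j e in \<open>auto dest: in_set_takeD\<close>)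
  then show ?thesis by blast
qed

subsection \<open>Isomorphism and subdivision\<close>

text \<open>The maps are explicit so that edge subsets can be carried along them and so that they
  can be extended to inserted vertices and edges.\<close>

definition isomorphism :: "('v \<Rightarrow> 'w) \<Rightarrow> ('e \<Rightarrow> 'f) \<Rightarrow> ('v, 'e) mgraph \<Rightarrow> ('w, 'f) mgraph \<Rightarrow> bool" where
  "isomorphism f g G H \<longleftrightarrow> bij_betw f (verts G) (verts H) \<and> bij_betw g (edges G) (edges H) \<and>
     (\<forall>e\<in>edges G. ends H (g e) = image_mset f (ends G e))"

lemma isomorphic_iff: "isomorphic G H \<longleftrightarrow> (\<exists>f g. isomorphism f g G H)"
  by (simp add: isomorphic_def isomorphism_def)

lemma isomorphism_trans:
  assumes "isomorphism f g G H" "isomorphism f' g' H K"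
  shows "isomorphism (f' \<circ> f) (g' \<circ> g) G K"
proof -
  have "g e \<in> edges H" if "e \<in> edges G" for e
    using assms(1) that unfolding isomorphism_def bij_betw_def by blast
  then show ?thesis
    using assms unfolding isomorphism_def by (auto intro: bij_betw_trans simp: image_mset.compositionality)
qed

lemma isomorphic_trans: "isomorphic G H \<Longrightarrow> isomorphic H K \<Longrightarrow> isomorphic G K"
  unfolding isomorphic_iff by (blast intro: isomorphism_trans)

lemma count_image_mset_inj_on:
  assumes "inj_on f V" "set_mset M \<subseteq> V" "x \<in> V"
  shows "count (image_mset f M) (f x) = count M x"
  using assms(2) by (induction M) (use assms(1,3) in \<open>auto simp: inj_on_eq_iff\<close>)

lemma isomorphism_sdeg:
  assumes "isomorphism f g G H" "finite_multigraph G" "s \<subseteq> edges G" "x \<in> verts G"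
  shows "sdeg H (g ` s) (f x) = sdeg G s x"
proof -
  have inj: "inj_on f (verts G)" "inj_on g s"
    using assms unfolding isomorphism_def bij_betw_def by (auto intro: inj_on_subset)
  have "count (ends H (g e)) (f x) = count (ends G e) x" if "e \<in> s" for e
  proof -
    have "set_mset (ends G e) \<subseteq> verts G"
      using that assms(3) finite_multigraphD(4)[OF assms(2)] by blast
    from count_image_mset_inj_on[OF inj(1) this assms(4)] show ?thesis
      using assms(1,3) that unfolding isomorphism_def by auto
  qed
  then show ?thesis unfolding sdeg_eq_sum using inj(2) by (simp add: sum.reindex)
qed

lemma isomorphism_degree:
  assumes "isomorphism f g G H" "finite_multigraph G" "x \<in> verts G"
  shows "f x \<in> verts H" "degree H (f x) = degree G x"
proof -
  have im: "g ` edges G = edges H" "f ` verts G = verts H"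
    using assms(1) by (auto simp: isomorphism_def bij_betw_def)
  then show "f x \<in> verts H" using assms(3) by blast
  show "degree H (f x) = degree G x"
    using isomorphism_sdeg[OF assms(1,2) order_refl assms(3)] im by simp
qed

lemma isomorphism_finite_multigraph:
  assumes "isomorphism f g G H" "finite_multigraph G"
  shows "finite_multigraph H"
proof -
  note fin = finite_multigraphD[OF assms(2)]
  have im: "edges H = g ` edges G" "verts H = f ` verts G"
    and e: "\<And>e. e \<in> edges G \<Longrightarrow> ends H (g e) = image_mset f (ends G e)"
    using assms(1) by (auto simp: isomorphism_def bij_betw_def)
  show ?thesis
    unfolding finite_multigraph_def multigraph_def im using fin by (auto simp: e)
qed

lemma isomorphism_connected:
  assumes "isomorphism f g G H" "connected_mgraph G"
  shows "connected_mgraph H"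
proof -
  have im: "edges H = g ` edges G" "verts H = f ` verts G"
    and e: "\<And>e. e \<in> edges G \<Longrightarrow> ends H (g e) = image_mset f (ends G e)"
    using assms(1) by (auto simp: isomorphism_def bij_betw_def)
  have "(f x, f y) \<in> (adjacency H)\<^sup>*" if "(x, y) \<in> (adjacency G)\<^sup>*" for x y
    using that
  proof induction
    case (step y z)
    then obtain a where "a \<in> edges G" "ends G a = {#y, z#}" by (auto simp: adjacency_def)
    then have "(f y, f z) \<in> adjacency H" using e im by (auto simp: adjacency_def intro!: bexI[of _ a])
    with step.IH show ?case by (rule rtrancl_into_rtrancl)
  qed simp
  then show ?thesis using assms(2) unfolding connected_mgraph_def im by auto
qed

text \<open>The condition for equality in the lower bound, named because it is carried from the core
  to the graph left after suppressing vertices of degree two.\<close>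

definition even_coregraphs :: "('v, 'e) mgraph \<Rightarrow> bool" where
  "even_coregraphs G \<longleftrightarrow> (\<forall>s\<in>sub_coregraphs G. \<forall>v\<in>verts G. even (sdeg G s v))"

lemma isomorphism_even_coregraphs:
  assumes "isomorphism f g G H" "finite_multigraph G" "even_coregraphs G"
  shows "even_coregraphs H"
  unfolding even_coregraphs_def
proof (intro ballI)
  fix t y assume t: "t \<in> sub_coregraphs H" and y: "y \<in> verts H"
  have im: "edges H = g ` edges G" "verts H = f ` verts G"
    using assms(1) by (auto simp: isomorphism_def bij_betw_def)
  from t obtain s where s: "s \<subseteq> edges G" "t = g ` s"
    unfolding sub_coregraphs_def im by (auto simp: subset_image_iff)
  obtain x where x: "x \<in> verts G" "y = f x" using y im by auto
  note deg = isomorphism_sdeg[OF assms(1,2) s(1)]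
  have "s \<in> sub_coregraphs G"
    using t s(1) im(2) deg unfolding sub_coregraphs_def s(2) by auto
  then show "even (sdeg H t y)"
    using assms(3) x deg s(2) unfolding even_coregraphs_def by auto
qed

text \<open>Suppressing a vertex needs a new edge name, and the edge type of the given graph may
  have none to spare; among the natural numbers there is always one.\<close>

lemma nat_copy:
  assumes "finite_multigraph G"
  obtains f g and N :: "(nat, nat) mgraph" where "isomorphism f g G N"
proof -
  obtain f where f: "bij_betw f (verts G) {0..<card (verts G)}"
    using ex_bij_betw_finite_nat finite_multigraphD(1)[OF assms] by blast
  obtain g where g: "bij_betw g (edges G) {0..<card (edges G)}"
    using ex_bij_betw_finite_nat finite_multigraphD(2)[OF assms] by blast
  have "isomorphism f g G \<lparr>verts = {0..<card (verts G)}, edges = {0..<card (edges G)},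
      ends = (\<lambda>e. image_mset f (ends G (inv_into (edges G) g e)))\<rparr>"
    using f g by (simp add: isomorphism_def bij_betw_inv_into_left)
  with that show thesis by blast
qed

text \<open>\<open>insert_vertex\<close> is split into an operation and its side conditions
  \<open>subdividable\<close>, so that degrees can be computed for fixed choices.\<close>

definition subdivide ::
  "('v, 'e) mgraph \<Rightarrow> 'e \<Rightarrow> 'v \<Rightarrow> 'v \<Rightarrow> 'v \<Rightarrow> 'e \<Rightarrow> 'e \<Rightarrow> ('v, 'e) mgraph" where
  "subdivide G e u v w e1 e2 =
     \<lparr>verts = insert w (verts G),
      edges = insert e1 (insert e2 (edges G - {e})),
      ends = (ends G)(e1 := {#u, w#}, e2 := {#w, v#})\<rparr>"

definition subdividable :: "('v, 'e) mgraph \<Rightarrow> 'e \<Rightarrow> 'v \<Rightarrow> 'v \<Rightarrow> 'v \<Rightarrow> 'e \<Rightarrow> 'e \<Rightarrow> bool" where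
  "subdividable G e u v w e1 e2 \<longleftrightarrow>
     e \<in> edges G \<and> ends G e = {#u, v#} \<and> w \<notin> verts G \<and> e1 \<notin> edges G \<and> e2 \<notin> edges G \<and> e1 \<noteq> e2"

lemma insert_vertex_iff:
  "insert_vertex G H \<longleftrightarrow>
     (\<exists>e u v w e1 e2. subdividable G e u v w e1 e2 \<and> H = subdivide G e u v w e1 e2)"
  unfolding insert_vertex_def subdivide_def subdividable_def by simp

lemma subdividable_ends:
  assumes "subdividable G e u v w e1 e2" "finite_multigraph G"
  shows "u \<in> verts G" "v \<in> verts G" "u \<noteq> w" "v \<noteq> w"
  using assms finite_multigraphD(4)[OF assms(2), of e] unfolding subdividable_def by auto

lemma finite_multigraph_subdivide:
  assumes "subdividable G e u v w e1 e2" "finite_multigraph G"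
  shows "finite_multigraph (subdivide G e u v w e1 e2)"
  using assms subdividable_ends[OF assms]
  unfolding subdivide_def subdividable_def finite_multigraph_def multigraph_def by auto

lemma sdeg_subdivide:
  assumes sub: "subdividable G e u v w e1 e2" and G: "finite_multigraph G" and s: "s \<subseteq> edges G"
  \<comment> \<open>The edge set of the subdivided graph that covers the same part as
    \<open>s\<close>: both halves of \<open>e\<close>, or neither.\<close>
  defines "t \<equiv> if e \<in> s then insert e1 (insert e2 (s - {e})) else s"
  shows "sdeg (subdivide G e u v w e1 e2) t x =
    (if x = w then if e \<in> s then 2 else 0 else sdeg G s x)"
proof -
  let ?H = "subdivide G e u v w e1 e2"
  have fin: "finite s" using s finite_multigraphD(2)[OF G] by (rule finite_subset)
  have notin: "e1 \<notin> s" "e2 \<notin> s" "e1 \<noteq> e2" "e1 \<noteq> e" "e2 \<noteq> e"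
    and e: "ends G e = {#u, v#}" and w: "w \<notin> verts G"
    using sub s unfolding subdividable_def by auto
  have same: "sdeg ?H r x = sdeg G r x" if "r \<subseteq> s" for r
    unfolding sdeg_eq_sum using notin that by (intro sum.cong) (auto simp: subdivide_def)
  have zero: "sdeg G r w = 0" if "r \<subseteq> s" for r
    unfolding sdeg_eq_sum using finite_multigraphD(4)[OF G] s that w
    by (intro sum.neutral) (auto simp: count_eq_zero_iff)
  show ?thesis
  proof (cases "e \<in> s")
    case False
    then show ?thesis using same[of s] zero[of s] by (simp add: t_def)
  next
    case True
    have "sdeg ?H t x = count {#u, w#} x + (count {#w, v#} x + sdeg ?H (s - {e}) x)"
      using True notin fin unfolding t_def sdeg_eq_sum by (simp add: subdivide_def)
    also have "sdeg ?H (s - {e}) x = sdeg G (s - {e}) x" by (rule same) auto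
    finally show ?thesis
      using True sdeg_remove[OF fin True, of G x] zero[of "s - {e}"] subdividable_ends[OF sub G] e
      by auto
  qed
qed

lemma subdivide_degree:
  assumes "subdividable G e u v w e1 e2" "finite_multigraph G"
  shows "degree (subdivide G e u v w e1 e2) x = (if x = w then 2 else degree G x)"
proof -
  let ?H = "subdivide G e u v w e1 e2"
  have "e \<in> edges G" using assms(1) by (simp add: subdividable_def)
  then have "sdeg ?H (insert e1 (insert e2 (edges G - {e}))) x = (if x = w then 2 else degree G x)"
    using sdeg_subdivide[OF assms order_refl, of x] by (simp only: if_True sdeg_edges)
  moreover have "insert e1 (insert e2 (edges G - {e})) = edges ?H" by (simp add: subdivide_def)
  ultimately show ?thesis by (simp only: sdeg_edges)
qed

text \<open>A sub-coregraph of \<open>G\<close> lifts to one of the subdivision: old vertices keep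
  their degrees and the new vertex gets 0 or 2.\<close>

lemma subdivide_even_coregraphs:
  assumes sub: "subdividable G e u v w e1 e2" and G: "finite_multigraph G"
    and even: "even_coregraphs (subdivide G e u v w e1 e2)"
  shows "even_coregraphs G"
  unfolding even_coregraphs_def
proof (intro ballI)
  fix s x assume s: "s \<in> sub_coregraphs G" and x: "x \<in> verts G"
  let ?H = "subdivide G e u v w e1 e2"
  define t where "t = (if e \<in> s then insert e1 (insert e2 (s - {e})) else s)"
  have sE: "s \<subseteq> edges G" using s by (simp add: sub_coregraphs_def)
  note deg = sdeg_subdivide[OF sub G sE, folded t_def]
  have "t \<subseteq> edges ?H" using sE by (auto simp: t_def subdivide_def)
  then have "t \<in> sub_coregraphs ?H"
    using s sub unfolding sub_coregraphs_def by (auto simp: deg) (auto simp: subdivide_def)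
  then have "even (sdeg ?H t x)"
    using even x unfolding even_coregraphs_def by (auto simp: subdivide_def)
  moreover have "x \<noteq> w" using sub x by (auto simp: subdividable_def)
  ultimately show "even (sdeg G s x)" by (simp add: deg)
qed

lemma insert_vertex_rtranclp_finite:
  assumes "insert_vertex\<^sup>*\<^sup>* G H" "finite_multigraph G"
  shows "finite_multigraph H"
  using assms by induction (auto simp: insert_vertex_iff finite_multigraph_subdivide)

text \<open>The insertion is repeated in \<open>H\<close> on the image of the edge, with new names,
  which exist since \<open>H\<close> is finite and lives on the natural numbers. The isomorphism is
  then extended by sending new names to new names.\<close>

lemma insert_vertex_transfer:
  fixes H :: "(nat, nat) mgraph"
  assumes "insert_vertex G G1" "isomorphism f g G H" "finite_multigraph G"
  shows "\<exists>H1. insert_vertex H H1 \<and> isomorphic G1 H1"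
proof -
  obtain e u v w e1 e2 where sub: "subdividable G e u v w e1 e2"
    and G1: "G1 = subdivide G e u v w e1 e2"
    using assms(1) by (auto simp: insert_vertex_iff)
  have H: "finite (verts H)" "finite (edges H)"
    using isomorphism_finite_multigraph[OF assms(2,3)] finite_multigraphD by blast+
  obtain w' where w': "w' \<notin> verts H" using H(1) ex_new_if_finite infinite_UNIV_nat by blast
  obtain e1' where e1': "e1' \<notin> edges H" using H(2) ex_new_if_finite infinite_UNIV_nat by blast
  obtain e2' where e2': "e2' \<notin> insert e1' (edges H)"
    using H(2) ex_new_if_finite[of "insert e1' (edges H)"] infinite_UNIV_nat by blast
  have bij: "bij_betw f (verts G) (verts H)" "bij_betw g (edges G) (edges H)"
    and ends: "\<And>a. a \<in> edges G \<Longrightarrow> ends H (g a) = image_mset f (ends G a)"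
    using assms(2) by (auto simp: isomorphism_def)
  have s: "e \<in> edges G" "ends G e = {#u, v#}" "w \<notin> verts G" "e1 \<notin> edges G" "e2 \<notin> edges G" "e1 \<noteq> e2"
    using sub by (auto simp: subdividable_def)
  have sub': "subdividable H (g e) (f u) (f v) w' e1' e2'"
    using s bij ends w' e1' e2' by (auto simp: subdividable_def bij_betw_def)
  define f' where "f' = f(w := w')"
  define g' where "g' = g(e1 := e1', e2 := e2')"
  have f_eq: "f' x = f x" if "x \<in> verts G" for x using that s by (auto simp: f'_def)
  have g_eq: "g' a = g a" if "a \<in> edges G" for a using that s by (auto simp: g'_def)
  have "bij_betw f' (verts G) (verts H)" using bij(1) f_eq by (simp cong: bij_betw_cong)
  then have "bij_betw f' (insert w (verts G)) (insert w' (verts H))"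
    using notIn_Un_bij_betw[of w "verts G" f' "verts H"] s w' by (simp add: f'_def)
  moreover have "bij_betw g' (insert e1 (insert e2 (edges G - {e}))) (insert e1' (insert e2' (edges H - {g e})))"
  proof -
    have "bij_betw g' (edges G) (edges H)" using bij(2) g_eq by (simp cong: bij_betw_cong)
    then have "bij_betw g' (edges G - {e}) (edges H - {g e})"
      using bij_betw_DiffI[of g' "edges G" "edges H" "{e}" "{g e}"] s g_eq by (auto simp: bij_betw_def)
    then have "bij_betw g' (insert e2 (edges G - {e})) (insert e2' (edges H - {g e}))"
      using notIn_Un_bij_betw[of e2 "edges G - {e}" g'] s e2' by (simp add: g'_def)
    then show ?thesis
      using notIn_Un_bij_betw[of e1 "insert e2 (edges G - {e})" g'] s e2' e1' by (simp add: g'_def)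
  qed
  moreover have "ends (subdivide H (g e) (f u) (f v) w' e1' e2') (g' a) = image_mset f' (ends G1 a)"
    if "a \<in> edges G1" for a
  proof -
    have uv: "f' u = f u" "f' v = f v" "f' w = w'" "g' e1 = e1'" "g' e2 = e2'"
      using subdividable_ends[OF sub assms(3)] f_eq s by (auto simp: f'_def g'_def)
    consider "a = e1" | "a = e2" | "a \<in> edges G" "a \<noteq> e" using \<open>a \<in> edges G1\<close> by (auto simp: G1 subdivide_def)
    then show ?thesis
    proof cases
      case 3
      have "image_mset f' (ends G a) = image_mset f (ends G a)"
        using finite_multigraphD(4)[OF assms(3) 3(1)] f_eq by (intro image_mset_cong) auto
      moreover have "g a \<in> edges H" using 3 bij by (auto simp: bij_betw_def)
      moreover have "a \<noteq> e1" "a \<noteq> e2" using 3 s by auto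
      ultimately show ?thesis using g_eq[OF 3(1)] ends[OF 3(1)] e1' e2' by (auto simp: G1 subdivide_def)
    qed (use uv s e2' in \<open>auto simp: G1 subdivide_def\<close>)
  qed
  ultimately have "isomorphism f' g' G1 (subdivide H (g e) (f u) (f v) w' e1' e2')"
    by (simp add: isomorphism_def G1) (simp add: subdivide_def)
  with sub' show ?thesis unfolding insert_vertex_iff isomorphic_iff by blast
qed

lemma insert_vertex_rtranclp_transfer:
  fixes H :: "(nat, nat) mgraph"
  assumes "insert_vertex\<^sup>*\<^sup>* G G1" "isomorphic G H" "finite_multigraph G"
  shows "\<exists>H1. insert_vertex\<^sup>*\<^sup>* H H1 \<and> isomorphic G1 H1"
  using assms(1)
proof induction
  case base
  then show ?case using assms(2) by blast
next
  case (step G1 G2)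
  from step.IH obtain H1 where H1: "insert_vertex\<^sup>*\<^sup>* H H1" "isomorphic G1 H1" by blast
  from insert_vertex_transfer[OF step.hyps(2)] obtain H2
    where "insert_vertex H1 H2" "isomorphic G2 H2"
    using H1(2) insert_vertex_rtranclp_finite[OF step.hyps(1) assms(3)] unfolding isomorphic_iff by metis
  with H1(1) show ?case by (meson rtranclp.rtrancl_into_rtrancl)
qed

lemma is_subdivision_isomorphic:
  fixes B :: "(nat, nat) mgraph"
  assumes "is_subdivision K H" "isomorphic H B" "finite_multigraph H"
  shows "is_subdivision K B"
  using assms insert_vertex_rtranclp_transfer unfolding is_subdivision_def
  by (meson isomorphic_trans)

lemma isomorphic_refl: "isomorphic G G"
  unfolding isomorphic_def by (intro exI[of _ id]) auto

text \<open>The graph \<open>H\<close> is isomorphic to the end of a chain of insertions that starts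
  at \<open>B\<close>. The insertion that leads from \<open>H\<close> to \<open>K1\<close> is
  transferred there and appended to the chain.\<close>

lemma is_subdivision_insert_vertex:
  fixes B :: "(nat, nat) mgraph"
  assumes "insert_vertex H K1" "isomorphic K K1" "is_subdivision H B" "finite_multigraph H"
  shows "is_subdivision K B"
proof -
  obtain H' where H': "insert_vertex\<^sup>*\<^sup>* B H'" "isomorphic H H'"
    using assms(3) unfolding is_subdivision_def by blast
  obtain K2 where "insert_vertex H' K2" "isomorphic K1 K2"
    using insert_vertex_transfer[OF assms(1)] H'(2) assms(4) unfolding isomorphic_iff by metis
  with H'(1) assms(2) show ?thesis
    unfolding is_subdivision_def by (meson isomorphic_trans rtranclp.rtrancl_into_rtrancl)
qed

subsection \<open>Suppressing vertices of degree two\<close>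

text \<open>The inverse of an insertion. The second vertex \<open>w'\<close> excludes a lone vertex
  with a loop: by connectedness one edge at \<open>w\<close> leads to some \<open>u\<close> other
  than \<open>w\<close>, and the remaining degree 1 comes from one further non-loop, to
  \<open>v\<close>. The case \<open>u = v\<close> is possible and produces a loop.\<close>

lemma smooth_vertex:
  fixes K :: "(nat, nat) mgraph"
  assumes K: "finite_multigraph K" "connected_mgraph K"
    and w: "w \<in> verts K" "degree K w = 2" and w2: "w' \<in> verts K" "w' \<noteq> w"
  obtains H e u v e1 e2 where "subdividable H e u v w e1 e2"
    "isomorphism id id K (subdivide H e u v w e1 e2)"
    "finite_multigraph H" "connected_mgraph H" "verts H = verts K - {w}"
proof -
  note fin = finite_multigraphD(1,2)[OF K(1)]
  obtain e1 u where e1: "e1 \<in> edges K" "ends K e1 = {#w, u#}" "u \<noteq> w" "u \<in> verts K"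
    using connected_nonloop[OF K w(1) w2(1)] w2(2) by metis
  have "sdeg K (edges K - {e1}) w = 1"
    using sdeg_remove[OF fin(2) e1(1), of K w] w(2) e1 by simp
  then have "\<exists>a\<in>edges K - {e1}. count (ends K a) w = 1 \<and>
      (\<forall>b\<in>edges K - {e1}. a \<noteq> b \<longrightarrow> count (ends K b) w = 0)"
    unfolding sdeg_eq_sum using fin(2) by (subst (asm) sum_eq_1_iff) simp_all
  then obtain e2 where e2: "e2 \<in> edges K" "e2 \<noteq> e1" "count (ends K e2) w = 1"
    and rest: "\<forall>b\<in>edges K - {e1}. e2 \<noteq> b \<longrightarrow> count (ends K b) w = 0"
    by blast
  have other: "w \<notin># ends K b" if "b \<in> edges K" "b \<noteq> e1" "b \<noteq> e2" for b
    using rest that by (simp add: count_eq_zero_iff)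
  have "w \<in># ends K e2" using e2(3) by (metis count_eq_zero_iff zero_neq_one)
  then obtain v where v: "ends K e2 = {#w, v#}"
    using size_two_witness finite_multigraphD(3)[OF K(1) e2(1)] by metis
  then have vw: "v \<noteq> w" "v \<in> verts K"
    using e2(3) finite_multigraphD(4)[OF K(1) e2(1)] by auto
  \<comment> \<open>Reusing \<open>e1\<close> or \<open>e2\<close> would violate
    \<open>subdividable\<close>, which requires both to be absent from \<open>H\<close>.\<close>
  obtain e where e: "e \<notin> edges K" using fin(2) ex_new_if_finite infinite_UNIV_nat by blast
  define H where "H = \<lparr>verts = verts K - {w}, edges = insert e (edges K - {e1, e2}),
    ends = (ends K)(e := {#u, v#})\<rparr>"
  have sub: "subdividable H e u v w e1 e2"
    using e e1 e2 by (auto simp: subdividable_def H_def)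
  \<comment> \<open>Not an equality, since \<open>ends\<close> may differ at \<open>e\<close>, which
    is an edge of neither graph.\<close>
  moreover have "isomorphism id id K (subdivide H e u v w e1 e2)"
    using e e1 e2 v w by (auto simp: isomorphism_def bij_betw_def subdivide_def H_def add_mset_commute)
  moreover have "finite_multigraph H"
    using K(1) other e1 vw unfolding finite_multigraph_def multigraph_def H_def by auto
  moreover have "connected_mgraph H"
  proof (rule connected_retract[OF K(2), where r = "\<lambda>y. if y = w then u else y"])
    fix a x y assume a: "a \<in> edges K" "ends K a = {#x, y#}"
    have uv: "(u, v) \<in> (adjacency H)\<^sup>*" "(v, u) \<in> (adjacency H)\<^sup>*"
      by (auto simp: H_def add_mset_commute intro!: adjacency_edge[of e])
    consider "a = e1" | "a = e2" | "a \<noteq> e1" "a \<noteq> e2" by blast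
    then show "(if x = w then u else x, if y = w then u else y) \<in> (adjacency H)\<^sup>*"
    proof cases
      case 1
      then have "{#x, y#} = {#w, u#}" using a e1 by simp
      then show ?thesis by (auto simp: add_eq_conv_ex)
    next
      case 2
      then have "{#x, y#} = {#w, v#}" using a v by simp
      then show ?thesis using uv vw by (auto simp: add_eq_conv_ex)
    next
      case 3
      then show ?thesis using a e other[OF a(1) 3]
        by (intro adjacency_edge[of a]) (auto simp: H_def)
    qed
  qed (use e1 H_def in auto)
  ultimately show thesis using that by (simp add: H_def)
qed

lemma connected_degree_pos:
  assumes "finite_multigraph K" "connected_mgraph K" "v \<in> verts K" "w \<in> verts K" "v \<noteq> w"
  shows "degree K v > 0"
proof -
  obtain e u where e: "e \<in> edges K" "ends K e = {#v, u#}"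
    using connected_nonloop[OF assms] by metis
  then have "degree K v = count (ends K e) v + sdeg K (edges K - {e}) v"
    using sdeg_remove[OF finite_multigraphD(2)[OF assms(1)] e(1), of K v] by simp
  with e show ?thesis by simp
qed

text \<open>As long as there are two vertices and some degree is below 3, that degree is 2:
  connectedness excludes 0 and the hypothesis excludes 1. Suppressing this vertex leaves the other
  degrees unchanged, so the hypothesis persists while the number of vertices drops.\<close>

lemma smoothing:
  fixes K :: "(nat, nat) mgraph"
  assumes "finite_multigraph K" "connected_mgraph K" "\<forall>v\<in>verts K. degree K v \<noteq> 1"
  shows "\<exists>H :: (nat, nat) mgraph. finite_multigraph H \<and> connected_mgraph H \<and> is_subdivision K H \<and>
    (\<forall>v\<in>verts H. v \<in> verts K \<and> degree H v = degree K v) \<and>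
    ((\<exists>v. verts H = {v}) \<or> (\<forall>v\<in>verts H. degree H v \<ge> 3)) \<and>
    (even_coregraphs K \<longrightarrow> even_coregraphs H)"
  using assms
proof (induction "card (verts K)" arbitrary: K rule: less_induct)
  case less
  note K = less.prems(1,2)
  show ?case
  proof (cases "(\<exists>v. verts K = {v}) \<or> (\<forall>v\<in>verts K. degree K v \<ge> 3)")
    case True
    moreover have "is_subdivision K K" unfolding is_subdivision_def using isomorphic_refl by blast
    ultimately show ?thesis using K by blast
  next
    case False
    then obtain w where w: "w \<in> verts K" "degree K w < 3" by auto
    then obtain w' where w': "w' \<in> verts K" "w' \<noteq> w" using False by blast
    have "degree K w > 0" "degree K w \<noteq> 1"
      using connected_degree_pos[OF K w(1) w'(1)] w w' less.prems(3) by auto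
    then have "degree K w = 2" using w(2) by simp
    then obtain H e u v e1 e2 where sub: "subdividable H e u v w e1 e2"
      and iso: "isomorphism id id K (subdivide H e u v w e1 e2)"
      and H: "finite_multigraph H" "connected_mgraph H" "verts H = verts K - {w}"
      using smooth_vertex[OF K w(1) _ w'] by metis
    have deg: "degree H x = degree K x" if "x \<in> verts H" for x
      using isomorphism_degree(2)[OF iso K(1), of x] subdivide_degree[OF sub H(1), of x] that H(3) by auto
    have "card (verts H) < card (verts K)"
      using H(3) w(1) finite_multigraphD(1)[OF K(1)] by (metis card_Diff1_less)
    moreover have "\<forall>x\<in>verts H. degree H x \<noteq> 1" using deg H(3) less.prems(3) by simp
    ultimately obtain H' :: "(nat, nat) mgraph" where H': "finite_multigraph H'" "connected_mgraph H'"
      "is_subdivision H H'" "\<forall>v\<in>verts H'. v \<in> verts H \<and> degree H' v = degree H v"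
      "(\<exists>v. verts H' = {v}) \<or> (\<forall>v\<in>verts H'. degree H' v \<ge> 3)"
      "even_coregraphs H \<longrightarrow> even_coregraphs H'"
      using less.hyps[of H] H by blast
    have "insert_vertex H (subdivide H e u v w e1 e2)" using sub unfolding insert_vertex_iff by blast
    moreover have "isomorphic K (subdivide H e u v w e1 e2)" using iso unfolding isomorphic_iff by blast
    ultimately have "is_subdivision K H'"
      using is_subdivision_insert_vertex H'(3) H(1) by blast
    moreover have "even_coregraphs K \<longrightarrow> even_coregraphs H'"
      using isomorphism_even_coregraphs[OF iso K(1)] subdivide_even_coregraphs[OF sub H(1)] H'(6) by blast
    moreover have "\<forall>v\<in>verts H'. v \<in> verts K \<and> degree H' v = degree K v"
      using H'(4) deg H(3) by auto
    ultimately show ?thesis using H'(1,2,5) by blast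
  qed
qed

lemma smoothing_isomorphic:
  fixes K :: "('v, 'e) mgraph"
  assumes K: "finite_multigraph K" "connected_mgraph K" "\<forall>v\<in>verts K. degree K v \<noteq> 1"
  obtains H :: "(nat, nat) mgraph" where "finite_multigraph H" "connected_mgraph H" "is_subdivision K H"
    "\<forall>v\<in>verts H. \<exists>x\<in>verts K. degree H v = degree K x"
    "(\<exists>v. verts H = {v}) \<or> (\<forall>v\<in>verts H. degree H v \<ge> 3)"
    "even_coregraphs K \<longrightarrow> even_coregraphs H"
proof -
  obtain f g and N :: "(nat, nat) mgraph" where N: "isomorphism f g K N"
    using nat_copy[OF K(1)] by blast
  have im: "verts N = f ` verts K" using N by (auto simp: isomorphism_def bij_betw_def)
  have degs: "\<forall>v\<in>verts N. \<exists>x\<in>verts K. degree N v = degree K x"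
    using isomorphism_degree(2)[OF N K(1)] im by auto
  then have "\<forall>v\<in>verts N. degree N v \<noteq> 1" using K(3) by metis
  then obtain H :: "(nat, nat) mgraph" where H: "finite_multigraph H" "connected_mgraph H" "is_subdivision N H"
    "\<forall>v\<in>verts H. v \<in> verts N \<and> degree H v = degree N v"
    "(\<exists>v. verts H = {v}) \<or> (\<forall>v\<in>verts H. degree H v \<ge> 3)"
    "even_coregraphs N \<longrightarrow> even_coregraphs H"
    using smoothing[of N] isomorphism_finite_multigraph[OF N K(1)] isomorphism_connected[OF N K(2)] by blast
  have "is_subdivision K H"
    using H(3) N unfolding is_subdivision_def isomorphic_iff by (blast intro: isomorphism_trans)
  moreover have "\<forall>v\<in>verts H. \<exists>x\<in>verts K. degree H v = degree K x" using H(4) degs by metis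
  moreover have "even_coregraphs K \<longrightarrow> even_coregraphs H"
    using isomorphism_even_coregraphs[OF N K(1)] H(6) by blast
  ultimately show thesis using that H(1,2,5) by blast
qed

section \<open>Cores that attain the bounds\<close>

lemma single_vertex_bouquet:
  assumes "finite_multigraph H" "verts H = {v}"
  shows "isomorphic H (bouquet (card (edges H)))"
proof -
  obtain h where h: "bij_betw h (edges H) {..<card (edges H)}"
    using finite_multigraphD(2)[OF assms(1)] by (metis card_lessThan finite_lessThan finite_same_card_bij)
  have "isomorphism (\<lambda>_. 0) h H (bouquet (card (edges H)))"
    using h single_vertex_loop[OF assms] by (auto simp: isomorphism_def bouquet_def assms(2) bij_betw_def)
  then show ?thesis unfolding isomorphic_iff by blast
qed

lemma even_coregraphs_imp_bouquet:
  fixes K :: "('v, 'e) mgraph"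
  assumes "finite_multigraph K" "connected_mgraph K" "\<forall>v\<in>verts K. degree K v \<noteq> 1" "even_coregraphs K"
  shows "subdivision_of_bouquet K"
proof -
  obtain H :: "(nat, nat) mgraph" where H: "finite_multigraph H" "connected_mgraph H" "is_subdivision K H"
    "(\<exists>v. verts H = {v}) \<or> (\<forall>v\<in>verts H. degree H v \<ge> 3)" "even_coregraphs H"
    using smoothing_isomorphic[OF assms(1-3)] assms(4) by metis
  note fin = finite_multigraphD(2)[OF H(1)]
  have "\<exists>v. verts H = {v}"
  proof (rule ccontr)
    assume not1: "\<not> ?thesis"
    then have deg: "\<forall>v\<in>verts H. degree H v \<ge> 3" using H(4) by blast
    obtain v w where vw: "v \<in> verts H" "w \<in> verts H" "v \<noteq> w"
      using H(2) not1 unfolding connected_mgraph_def by blast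
    obtain e u where e: "e \<in> edges H" "ends H e = {#v, u#}" "u \<noteq> v"
      using connected_nonloop[OF H(1,2) vw] by metis
    have rem: "degree H x = count (ends H e) x + sdeg H (edges H - {e}) x" for x
      using sdeg_remove[OF fin e(1), of H x] by simp
    \<comment> \<open>Removing a non-loop lowers a degree by at most one, from at least 3 to at
      least 2.\<close>
    have "sdeg H (edges H - {e}) x \<noteq> 1" if "x \<in> verts H" for x
    proof -
      have "count (ends H e) x \<le> 1" using e by auto
      moreover have "degree H x \<ge> 3" using deg that by blast
      ultimately show ?thesis using rem[of x] by linarith
    qed
    then have "edges H - {e} \<in> sub_coregraphs H" by (auto simp: sub_coregraphs_def)
    moreover have "edges H \<in> sub_coregraphs H" using deg by (force simp: sub_coregraphs_def)
    ultimately have "even (sdeg H (edges H - {e}) v)" "even (degree H v)"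
      using H(5) vw(1) unfolding even_coregraphs_def by (metis sdeg_edges)+
    with rem[of v] e show False by simp
  qed
  then obtain v where v: "verts H = {v}" by blast
  show ?thesis
    unfolding subdivision_of_bouquet_def
    using is_subdivision_isomorphic[OF H(3) single_vertex_bouquet[OF H(1) v] H(1)] by blast
qed

lemma degree_zero_edgeless:
  assumes "finite_multigraph K" "connected_mgraph K" "v \<in> verts K" "degree K v = 0"
  shows "edges K = {}"
proof -
  have V: "verts K = {v}" using connected_degree_pos[OF assms(1-3)] assms(3,4) by auto
  have "sdeg K (edges K) v = 2 * card (edges K)"
    by (rule single_vertex_sdeg[OF assms(1) V order_refl])
  then show ?thesis using assms(4) finite_multigraphD(2)[OF assms(1)] by simp
qed

text \<open>After suppression, minimum degree 3 meets the bound 3 and the graph is 3-regular.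
  Otherwise one vertex remains, whose even degree is at most 3: it carries one loop, the exceptional
  case of nullity one, or no edge.\<close>

lemma degree_le_3_imp:
  fixes K :: "('v, 'e) mgraph"
  assumes K: "finite_multigraph K" "connected_mgraph K" "\<forall>v\<in>verts K. degree K v \<noteq> 1"
    and le: "\<forall>v\<in>verts K. degree K v \<le> 3"
  shows "subdivision_of_3_regular K \<or> subdivision_of_loop K \<or> edges K = {}"
proof -
  obtain H :: "(nat, nat) mgraph" where H: "finite_multigraph H" "connected_mgraph H" "is_subdivision K H"
    "\<forall>v\<in>verts H. \<exists>x\<in>verts K. degree H v = degree K x"
    "(\<exists>v. verts H = {v}) \<or> (\<forall>v\<in>verts H. degree H v \<ge> 3)"
    using smoothing_isomorphic[OF K] by metis
  show ?thesis
  proof (cases "\<forall>v\<in>verts H. degree H v \<ge> 3")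
    case True
    then have "regular 3 H" unfolding regular_def using H(4) le by (metis le_antisym)
    then show ?thesis unfolding subdivision_of_3_regular_def using H(1,3) by blast
  next
    case False
    then obtain v where v: "verts H = {v}" using H(5) by blast
    obtain x where x: "x \<in> verts K" "degree H v = degree K x" using H(4) v by auto
    have "degree H v = 2 * card (edges H)"
      using single_vertex_sdeg[OF H(1) v order_refl] by simp
    then have "card (edges H) = 1 \<or> degree K x = 0" using x le by (cases "card (edges H)") force+
    then show ?thesis
    proof
      assume "card (edges H) = 1"
      then show ?thesis
        unfolding subdivision_of_loop_def
        using is_subdivision_isomorphic[OF H(3) single_vertex_bouquet[OF H(1) v] H(1)] by simp
    next
      assume "degree K x = 0"
      with degree_zero_edgeless[OF K(1,2) x(1)] show ?thesis by blast
    qed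
  qed
qed

lemma insert_vertex_rtranclp_degree:
  assumes "insert_vertex\<^sup>*\<^sup>* G H" "finite_multigraph G"
  shows "verts G \<subseteq> verts H \<and> (\<forall>v\<in>verts H. degree H v = (if v \<in> verts G then degree G v else 2))"
  using assms(1)
proof induction
  case (step H1 H2)
  then obtain e u v w e1 e2 where sub: "subdividable H1 e u v w e1 e2"
    and H2: "H2 = subdivide H1 e u v w e1 e2"
    by (auto simp: insert_vertex_iff)
  have "w \<notin> verts H1" using sub by (simp add: subdividable_def)
  moreover have "verts H2 = insert w (verts H1)" by (simp add: H2 subdivide_def)
  moreover have "degree H2 x = (if x = w then 2 else degree H1 x)" for x
    unfolding H2 by (rule subdivide_degree[OF sub insert_vertex_rtranclp_finite[OF step.hyps(1) assms(2)]])
  ultimately show ?case using step.IH by auto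
qed auto

text \<open>Injectivity of \<open>f\<close> ensures that at most one vertex of a subdivided bouquet
  lies over the vertex of the bouquet.\<close>

lemma is_subdivision_degree:
  assumes K: "finite_multigraph K" and H: "finite_multigraph H" and "is_subdivision K H"
  obtains f where "inj_on f (verts K)"
    "\<forall>x\<in>verts K. degree K x = (if f x \<in> verts H then degree H (f x) else 2)"
proof -
  obtain K' f g where K': "insert_vertex\<^sup>*\<^sup>* H K'" "isomorphism f g K K'"
    using assms(3) unfolding is_subdivision_def isomorphic_iff by blast
  have "inj_on f (verts K)" using K'(2) by (simp add: isomorphism_def bij_betw_def)
  moreover have "degree K x = (if f x \<in> verts H then degree H (f x) else 2)" if "x \<in> verts K" for x
    using isomorphism_degree[OF K'(2) K that] insert_vertex_rtranclp_degree[OF K'(1) H] by auto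
  ultimately show thesis using that by blast
qed

lemma handshake:
  assumes "finite_multigraph G" "s \<subseteq> edges G"
  shows "(\<Sum>v\<in>verts G. sdeg G s v) = 2 * card s"
proof -
  note fin = finite_multigraphD[OF assms(1)]
  have "(\<Sum>v\<in>verts G. sdeg G s v) = (\<Sum>e\<in>s. \<Sum>v\<in>verts G. count (ends G e) v)"
    unfolding sdeg_eq_sum by (rule sum.swap)
  also have "\<dots> = (\<Sum>e\<in>s. 2)"
  proof (rule sum.cong[OF refl])
    fix e assume "e \<in> s"
    then have e: "size (ends G e) = 2" "set_mset (ends G e) \<subseteq> verts G" using fin(3,4) assms(2) by blast+
    have "(\<Sum>v\<in>verts G. count (ends G e) v) = (\<Sum>v\<in>set_mset (ends G e). count (ends G e) v)"
      using e(2) fin(1) by (intro sum.mono_neutral_right) (auto simp: count_eq_zero_iff)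
    then show "(\<Sum>v\<in>verts G. count (ends G e) v) = 2" using e(1) by (simp add: size_multiset_overloaded_eq)
  qed
  finally show ?thesis by simp
qed

lemma finite_multigraph_bouquet: "finite_multigraph (bouquet n)"
  by (simp add: finite_multigraph_def multigraph_def bouquet_def)

text \<open>All vertices but at most one have degree 2 in \<open>K\<close>, hence degree 0 or 2 in a
  sub-coregraph. The degree sum is even, so the degree of the remaining vertex is even too.\<close>

lemma bouquet_imp_even_coregraphs:
  assumes K: "finite_multigraph K" and "subdivision_of_bouquet K"
  shows "even_coregraphs K"
proof -
  note fin = finite_multigraphD(1,2)[OF K]
  obtain n where "is_subdivision K (bouquet n)" using assms(2) unfolding subdivision_of_bouquet_def by blast
  then obtain f where f: "inj_on f (verts K)"
    "\<forall>x\<in>verts K. degree K x = (if f x \<in> verts (bouquet n) then degree (bouquet n) (f x) else 2)"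
    using is_subdivision_degree[OF K finite_multigraph_bouquet] by metis
  have two: "degree K x = 2" if "x \<in> verts K" "f x \<noteq> 0" for x
    using f(2) that by (simp add: bouquet_def)
  show ?thesis
    unfolding even_coregraphs_def
  proof (intro ballI)
    fix s v assume s: "s \<in> sub_coregraphs K" and v: "v \<in> verts K"
    have sE: "s \<subseteq> edges K" and s1: "\<And>x. x \<in> verts K \<Longrightarrow> sdeg K s x \<noteq> 1"
      using s by (auto simp: sub_coregraphs_def)
    have ev: "even (sdeg K s x)" if "x \<in> verts K" "f x \<noteq> 0" for x
    proof -
      have "sdeg K s x \<le> 2" using sdeg_mono[OF fin(2) sE, of K x] two[OF that] by simp
      then have "sdeg K s x = 0 \<or> sdeg K s x = 2" using s1[OF that(1)] by linarith
      then show ?thesis by auto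
    qed
    show "even (sdeg K s v)"
    proof (cases "f v = 0")
      case False
      then show ?thesis using ev v by blast
    next
      case True
      have "even (\<Sum>x\<in>verts K - {v}. sdeg K s x)"
      proof (rule dvd_sum)
        fix x assume x: "x \<in> verts K - {v}"
        then have "f x \<noteq> 0" using True inj_onD[OF f(1), of x v] v by auto
        then show "even (sdeg K s x)" using ev x by blast
      qed
      moreover have "sdeg K s v + (\<Sum>x\<in>verts K - {v}. sdeg K s x) = 2 * card s"
        using handshake[OF K sE] sum.remove[OF fin(1) v, of "sdeg K s"] by simp
      ultimately show ?thesis by (metis dvd_triv_left even_add)
    qed
  qed
qed

lemma subdivision_degree_le_3:
  assumes K: "finite_multigraph K" and "subdivision_of_3_regular K \<or> subdivision_of_loop K"
  shows "\<forall>v\<in>verts K. degree K v \<le> 3"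
proof -
  have bound: ?thesis if H: "finite_multigraph H" "\<forall>v\<in>verts H. degree H v \<le> 3" "is_subdivision K H"
    for H :: "(nat, nat) mgraph"
  proof -
    obtain f where "\<forall>x\<in>verts K. degree K x = (if f x \<in> verts H then degree H (f x) else 2)"
      using is_subdivision_degree[OF K H(1,3)] by metis
    then show ?thesis using H(2) by auto
  qed
  from assms(2) show ?thesis
  proof
    assume "subdivision_of_3_regular K"
    then show ?thesis
      unfolding subdivision_of_3_regular_def regular_def using bound by (metis order_refl)
  next
    assume "subdivision_of_loop K"
    then have "is_subdivision K (bouquet 1)" by (simp add: subdivision_of_loop_def)
    moreover have "\<forall>v\<in>verts (bouquet 1). degree (bouquet 1) v \<le> 3" by (simp add: bouquet_def degree_def)
    ultimately show ?thesis using bound finite_multigraph_bouquet by blast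
  qed
qed

theorem theorem7p5:
  fixes G :: "('v, 'e) mgraph"
  assumes "finite_multigraph G"
    and "connected_mgraph G"
  shows "2 powi (nullity G) \<le> real (card (sub_coregraphs G))
    \<and> real (card (sub_coregraphs G))
        \<le> ((5 - sqrt 5) / 2) powi (nullity G - 1) + ((5 + sqrt 5) / 2) powi (nullity G - 1)
    \<and> (real (card (sub_coregraphs G)) = 2 powi (nullity G)
         \<longleftrightarrow> subdivision_of_bouquet (core G))
    \<and> (real (card (sub_coregraphs G))
          = ((5 - sqrt 5) / 2) powi (nullity G - 1) + ((5 + sqrt 5) / 2) powi (nullity G - 1)
         \<longleftrightarrow> subdivision_of_3_regular (core G) \<or> tree G
             \<or> subdivision_of_loop (core G))"
proof -
  define K where "K = core G"
  have inv: "finite_multigraph K" "connected_mgraph K" "nullity K = nullity G"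
    "sub_coregraphs K = sub_coregraphs G" "\<And>vs es. is_cycle K vs es \<longleftrightarrow> is_cycle G vs es"
    using delete_leaf_rtranclp_invariants[OF core_spec(1)[OF assms(1)] assms] unfolding K_def by blast+
  note bounds = sub_coregraphs_bounds[OF inv(1,2), unfolded inv(3,4)]
  have deg1: "\<forall>v\<in>verts K. degree K v \<noteq> 1"
    using core_spec(2)[OF assms(1)] by (simp add: K_def)
  have lower: "(\<forall>s\<in>sub_coregraphs G. \<forall>v\<in>verts K. even (sdeg K s v)) \<longleftrightarrow> subdivision_of_bouquet K"
    using even_coregraphs_imp_bouquet[OF inv(1,2) deg1] bouquet_imp_even_coregraphs[OF inv(1)]
    unfolding even_coregraphs_def inv(4) by blast
  \<comment> \<open>The full edge set of the core is itself a sub-coregraph, and it has the largest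
    degrees.\<close>
  have "(\<forall>s\<in>sub_coregraphs K. \<forall>v\<in>verts K. sdeg K s v \<le> 3) \<longleftrightarrow> (\<forall>v\<in>verts K. degree K v \<le> 3)"
  proof
    have "edges K \<in> sub_coregraphs K" using deg1 by (simp add: sub_coregraphs_def)
    moreover assume "\<forall>s\<in>sub_coregraphs K. \<forall>v\<in>verts K. sdeg K s v \<le> 3"
    ultimately show "\<forall>v\<in>verts K. degree K v \<le> 3" by (metis sdeg_edges)
  next
    assume *: "\<forall>v\<in>verts K. degree K v \<le> 3"
    show "\<forall>s\<in>sub_coregraphs K. \<forall>v\<in>verts K. sdeg K s v \<le> 3"
    proof (intro ballI)
      fix s v assume s: "s \<in> sub_coregraphs K" and v: "v \<in> verts K"
      have "s \<subseteq> edges K" using s by (simp add: sub_coregraphs_def)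
      from sdeg_mono[OF finite_multigraphD(2)[OF inv(1)] this, of K v]
      show "sdeg K s v \<le> 3" using * v by fastforce
    qed
  qed
  also have "\<dots> \<longleftrightarrow> subdivision_of_3_regular K \<or> edges K = {} \<or> subdivision_of_loop K"
    using degree_le_3_imp[OF inv(1,2) deg1] subdivision_degree_le_3[OF inv(1)]
    by (auto simp: degree_def)
  \<comment> \<open>\<open>K\<close> and \<open>G\<close> have the same cycles. Without cycles some
    vertex of \<open>K\<close> has degree below 2, hence 0, and connectedness leaves only that
    vertex.\<close>
  also have "edges K = {} \<longleftrightarrow> tree G"
  proof
    assume "edges K = {}"
    then have "\<not> is_cycle K vs es" for vs es by (auto simp: is_cycle_def)
    then show "tree G" using assms(2) inv(5) by (simp add: tree_def)
  next
    assume "tree G"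
    then have "\<not> (\<exists>vs es. is_cycle K vs es)" using inv(5) by (simp add: tree_def)
    moreover have "verts K \<noteq> {}" using inv(2) by (simp add: connected_mgraph_def)
    ultimately obtain v where "v \<in> verts K" "\<not> degree K v \<ge> 2"
      using cycle_exists[OF inv(1)] by blast
    moreover from this have "degree K v = 0" using deg1 by (metis One_nat_def less_2_cases not_less)
    ultimately show "edges K = {}" using degree_zero_edgeless[OF inv(1,2)] by blast
  qed
  finally have upper: "(\<forall>s\<in>sub_coregraphs G. \<forall>v\<in>verts K. sdeg K s v \<le> 3) \<longleftrightarrow>
      subdivision_of_3_regular K \<or> tree G \<or> subdivision_of_loop K"
    unfolding inv(4) .
  show ?thesis
    using bounds[unfolded lower upper, unfolded K_def] by blast
qed

end
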